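(* Let $p\geq 3$ be a prime, let $c\in\mathbb{Z}_p$, let $f_c(z)=z^2+c$, and suppose $0$ has finite orbit under $f_c$. (1) If $0$ is periodic of exact period $n$, then the critical orbit tree of $f_c$ coincides with the critical orbit tree (mod $p$). It is a finite tree with a single vertex of degree $n$ (with $n$ end points attached to it), and $f_c$ acts on the $n$ end points by a cyclic permutation. (2) If $0$ is strictly pre-periodic with orbit type $(m,n)$, $m>0$, then the critical orbit tree of $f_c$ either coincides with the critical orbit tree (mod $p$) or differs from it by one instance of branching.
   Context: The orbit type of $0$ is the minimal pair $(m,n)$, $m\ge0$, $n\ge1$, with $f_c^{m+n}(0)=f_c^m(0)$; the orbit type (mod $p$) is the same notion for the map induced by $f_c$ on $\mathbb{Z}_p/p\mathbb{Z}_p$. The $\mathbb{Z}_p$ tree is the rooted tree whose vertices at level $k\ge 0$ are the $p^k$ closed disks $D(a,p^{-k})=\{x\in\mathbb{Z}_p: |x-a|\le p^{-k}\}$ (equivalently, residue classes mod $p^k$), with root $D(0,1)=\mathbb{Z}_p$, and with an edge between two disks of consecutive radii when one contains the other. The ends of the tree are the elements of $\mathbb{Z}_p$. The map $f_c$ acts on vertices and ends. The critical orbit tree of $f_c$ is the convex hull (from the root) of the critical orbit $\{0,f_c(0),f_c^2(0),\dots\}$ in this tree, i.e. the union of the paths from the root to the points of the orbit, together with the induced action of $f_c$. The critical orbit tree (mod $p$) is the part of it consisting of the root and the level-1 vertices (residue classes mod $p$) containing points of the critical orbit, with the induced action. The critical orbit tree coincides with the critical orbit tree (mod $p$) if there is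 no branching below level 1, i.e. every residue class mod $p$ contains at most one point of the critical orbit (unbranched paths descending to an end are identified with their top portion). It differs from the critical orbit tree (mod $p$) by one instance of branching if there are integers $k\ge 1$ and $r\ge 2$ such that: each level-1 vertex of the critical orbit tree that is periodic (i.e. belongs to the cycle of the orbit mod $p$) has a single descendant in the critical orbit tree at level $k$, this descendant has exactly $r$ children in the critical orbit tree (at level $k+1$), and each of these children contains exactly one point of the critical orbit; and each level-1 vertex of the critical orbit tree that is not periodic contains exactly one point of the critical orbit. *)

theory Defs
  imports
    Complex_Main
    "HOL-Computational_Algebra.Primes"
    "HOL-Algebra.Ring"
    "HOL-Combinatorics.Orbits"
    "Graph_Theory.Pair_Digraph"
begin

section \<open>The ring of p-adic integers\<close>

text \<open>
  The inverse limit of the rings of integers modulo \<open>p ^ k\<close>: an element is the sequence of its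
  canonical residues, \<open>x k\<close> being the residue modulo \<open>p ^ k\<close>.
\<close>

definition Zp :: "nat \<Rightarrow> (nat \<Rightarrow> int) ring" where
  "Zp p = \<lparr>
     carrier = {x. \<forall>k. 0 \<le> x k \<and> x k < int p ^ k \<and> x (Suc k) mod int p ^ k = x k},
     mult = (\<lambda>x y k. (x k * y k) mod int p ^ k),
     one = (\<lambda>k. 1 mod int p ^ k),
     zero = (\<lambda>k. 0),
     add = (\<lambda>x y k. (x k + y k) mod int p ^ k)\<rparr>"

text \<open>For nonzero \<open>x\<close>, the greatest \<open>k\<close> with \<open>x k = 0\<close> is the p-adic valuation of \<open>x\<close>.\<close>

definition padic_abs :: "nat \<Rightarrow> (nat \<Rightarrow> int) \<Rightarrow> real" where
  "padic_abs p x =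
     (if x = \<zero>\<^bsub>Zp p\<^esub> then 0 else 1 / real p ^ (GREATEST k. x k = 0))"

definition closed_disk :: "nat \<Rightarrow> (nat \<Rightarrow> int) \<Rightarrow> real \<Rightarrow> (nat \<Rightarrow> int) set" where
  "closed_disk p a r = {x \<in> carrier (Zp p). padic_abs p (x \<ominus>\<^bsub>Zp p\<^esub> a) \<le> r}"


section \<open>Orbits\<close>

definition quad_map :: "nat \<Rightarrow> (nat \<Rightarrow> int) \<Rightarrow> (nat \<Rightarrow> int) \<Rightarrow> (nat \<Rightarrow> int)" where
  "quad_map p c z = z [^]\<^bsub>Zp p\<^esub> (2::nat) \<oplus>\<^bsub>Zp p\<^esub> c"

text \<open>
  The library's \<open>orbit f x\<close> starts with \<open>f x\<close>; here the starting point belongs to the orbit.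
\<close>

definition critical_orbit :: "nat \<Rightarrow> (nat \<Rightarrow> int) \<Rightarrow> (nat \<Rightarrow> int) set" where
  "critical_orbit p c = {(quad_map p c ^^ i) \<zero>\<^bsub>Zp p\<^esub> | i. True}"

definition has_exact_period :: "('a \<Rightarrow> 'a) \<Rightarrow> 'a \<Rightarrow> nat \<Rightarrow> bool" where
  "has_exact_period f x n \<longleftrightarrow>
     1 \<le> n \<and> (f ^^ n) x = x \<and> (\<forall>j. 1 \<le> j \<and> j < n \<longrightarrow> (f ^^ j) x \<noteq> x)"

definition has_orbit_type :: "('a \<Rightarrow> 'a) \<Rightarrow> 'a \<Rightarrow> nat \<Rightarrow> nat \<Rightarrow> bool" where
  "has_orbit_type f x m n \<longleftrightarrow>
     1 \<le> n \<and> (f ^^ (m + n)) x = (f ^^ m) x \<and>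
     (\<forall>m' n'. 1 \<le> n' \<and> (f ^^ (m' + n')) x = (f ^^ m') x \<longrightarrow> m \<le> m' \<and> n \<le> n')"


section \<open>Trees\<close>

text \<open>
  Undirected graphs are symmetric digraphs, so that \<open>out_degree\<close> is the degree. The \<open>tree\<close> of the
  graph library counts a pair of opposite arcs as a cycle and is therefore not usable for them;
  a tree is taken to be a nonempty graph in which any two vertices are joined by exactly one
  simple path.
\<close>

definition finite_tree :: "'a pair_pre_digraph \<Rightarrow> bool" where
  "finite_tree T \<longleftrightarrow>
     pair_graph T \<and> pverts T \<noteq> {} \<and>
     (\<forall>u\<in>pverts T. \<forall>v\<in>pverts T. \<exists>!q. pre_digraph.apath T u q v)"

definition level :: "nat \<Rightarrow> nat \<Rightarrow> (nat \<Rightarrow> int) set set" where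
  "level p k = {closed_disk p a (1 / real p ^ k) | a. a \<in> carrier (Zp p)}"

definition padic_tree :: "nat \<Rightarrow> (nat \<Rightarrow> int) set pair_pre_digraph" where
  "padic_tree p = \<lparr>
     pverts = (\<Union>k. level p k),
     parcs = {(u, v). \<exists>k. (u \<in> level p k \<and> v \<in> level p (Suc k) \<and> v \<subseteq> u) \<or>
                          (v \<in> level p k \<and> u \<in> level p (Suc k) \<and> u \<subseteq> v)}\<rparr>"

definition tree_root :: "nat \<Rightarrow> (nat \<Rightarrow> int) set" where
  "tree_root p = closed_disk p \<zero>\<^bsub>Zp p\<^esub> 1"

definition path_to :: "nat \<Rightarrow> (nat \<Rightarrow> int) \<Rightarrow> (nat \<Rightarrow> int) set set" where
  "path_to p x = {closed_disk p x (1 / real p ^ k) | k. True}"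

text \<open>
  The map sends a disk into, in general not onto, a disk of the same radius. The level \<open>k\<close> is
  determined by \<open>v\<close>, since disks of different radii are different sets.
\<close>

definition vertex_map :: "nat \<Rightarrow> (nat \<Rightarrow> int) \<Rightarrow> (nat \<Rightarrow> int) set \<Rightarrow> (nat \<Rightarrow> int) set" where
  "vertex_map p c v =
     (THE w. \<exists>k. v \<in> level p k \<and> w \<in> level p k \<and> quad_map p c ` v \<subseteq> w)"

definition induced :: "'a pair_pre_digraph \<Rightarrow> 'a set \<Rightarrow> 'a pair_pre_digraph" where
  "induced T W = \<lparr>pverts = W, parcs = parcs T \<inter> (W \<times> W)\<rparr>"

definition critical_orbit_tree ::
    "nat \<Rightarrow> (nat \<Rightarrow> int) \<Rightarrow> (nat \<Rightarrow> int) set pair_pre_digraph" where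
  "critical_orbit_tree p c =
     induced (padic_tree p) (\<Union>x\<in>critical_orbit p c. path_to p x)"

definition critical_orbit_tree_mod ::
    "nat \<Rightarrow> (nat \<Rightarrow> int) \<Rightarrow> (nat \<Rightarrow> int) set pair_pre_digraph" where
  "critical_orbit_tree_mod p c =
     induced (padic_tree p)
       (insert (tree_root p) (pverts (critical_orbit_tree p c) \<inter> level p 1))"

text \<open>
  The critical orbit tree after identifying every unbranched path that descends to an end with
  its top portion: the vertices strictly below a vertex other than the root which contains only
  one point of the critical orbit are removed. The vertices of level 1 always stay.
\<close>

definition trimmed_critical_orbit_tree ::
    "nat \<Rightarrow> (nat \<Rightarrow> int) \<Rightarrow> (nat \<Rightarrow> int) set pair_pre_digraph" where
  "trimmed_critical_orbit_tree p c =
     induced (padic_tree p)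
       {v \<in> pverts (critical_orbit_tree p c).
          \<forall>w\<in>pverts (critical_orbit_tree p c). v \<subset> w \<and> w \<noteq> tree_root p \<longrightarrow>
            (\<exists>x\<in>w \<inter> critical_orbit p c. \<exists>y\<in>w \<inter> critical_orbit p c. x \<noteq> y)}"

text \<open>
  No branching below level 1. Lemma \<open>coincides_mod_iff\<close> below relates this to equality of trees.
\<close>

definition coincides_mod :: "nat \<Rightarrow> (nat \<Rightarrow> int) \<Rightarrow> bool" where
  "coincides_mod p c \<longleftrightarrow>
     (\<forall>v\<in>level p 1. \<forall>x\<in>v \<inter> critical_orbit p c. \<forall>y\<in>v \<inter> critical_orbit p c. x = y)"

definition descendants ::
    "nat \<Rightarrow> (nat \<Rightarrow> int) \<Rightarrow> nat \<Rightarrow> (nat \<Rightarrow> int) set \<Rightarrow> (nat \<Rightarrow> int) set set" where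
  "descendants p c k v = {w \<in> pverts (critical_orbit_tree p c). w \<in> level p k \<and> w \<subseteq> v}"

definition periodic_vertex :: "nat \<Rightarrow> (nat \<Rightarrow> int) \<Rightarrow> (nat \<Rightarrow> int) set \<Rightarrow> bool" where
  "periodic_vertex p c v \<longleftrightarrow> (\<exists>j\<ge>1. (vertex_map p c ^^ j) v = v)"

definition one_branching :: "nat \<Rightarrow> (nat \<Rightarrow> int) \<Rightarrow> bool" where
  "one_branching p c \<longleftrightarrow>
     (\<exists>k\<ge>1. \<exists>r\<ge>2. \<forall>v\<in>pverts (critical_orbit_tree p c) \<inter> level p 1.
        (if periodic_vertex p c v
         then \<exists>w. descendants p c k v = {w} \<and>
                  card (descendants p c (Suc k) w) = r \<and>
                  (\<forall>u\<in>descendants p c (Suc k) w. \<exists>!x. x \<in> u \<inter> critical_orbit p c)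
         else \<exists>!x. x \<in> v \<inter> critical_orbit p c))"

text \<open>
  A finite tree consisting of one vertex \<open>z\<close> of degree \<open>n\<close> and \<open>n\<close> end points attached to it
  (for \<open>n = 1\<close> the vertex \<open>z\<close> also has degree 1, but does not count as an end point).
\<close>

definition star_tree :: "'a pair_pre_digraph \<Rightarrow> 'a \<Rightarrow> nat \<Rightarrow> bool" where
  "star_tree T z n \<longleftrightarrow>
     finite_tree T \<and> z \<in> pverts T \<and> out_degree T z = n \<and>
     card (pverts T - {z}) = n \<and>
     (\<forall>v\<in>pverts T - {z}. (z, v) \<in> parcs T \<and> out_degree T v = 1)"


section \<open>Consistency of the definitions\<close>

lemma Zp_simps:
  "mult (Zp p) x y = (\<lambda>k. (x k * y k) mod int p ^ k)"
  "one (Zp p) = (\<lambda>k. 1 mod int p ^ k)"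
  "zero (Zp p) = (\<lambda>k. 0)"
  "add (Zp p) x y = (\<lambda>k. (x k + y k) mod int p ^ k)"
  by (simp_all add: Zp_def)

lemma Zp_carrier_iff:
  "x \<in> carrier (Zp p) \<longleftrightarrow>
     (\<forall>k. 0 \<le> x k \<and> x k < int p ^ k \<and> x (Suc k) mod int p ^ k = x k)"
  by (simp add: Zp_def)

lemma Zp_closedI:
  assumes "0 < p" "\<And>k. g (Suc k) mod int p ^ k = g k mod int p ^ k"
  shows "(\<lambda>k. g k mod int p ^ k) \<in> carrier (Zp p)"
  unfolding Zp_carrier_iff using assms by (simp add: mod_mod_cancel)

lemma Zp_mod [simp]: "x \<in> carrier (Zp p) \<Longrightarrow> x k mod int p ^ k = x k"
  by (simp add: Zp_carrier_iff)

lemma Zp_cong: "x \<in> carrier (Zp p) \<Longrightarrow> x (Suc k) mod int p ^ k = x k mod int p ^ k"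
  by (simp add: Zp_carrier_iff)

lemma Zp_add_closed:
  "0 < p \<Longrightarrow> x \<in> carrier (Zp p) \<Longrightarrow> y \<in> carrier (Zp p) \<Longrightarrow> add (Zp p) x y \<in> carrier (Zp p)"
  unfolding Zp_simps
  by (rule Zp_closedI[where g = "\<lambda>k. x k + y k"]) (auto intro!: mod_add_cong simp del: Zp_mod simp: Zp_cong)

lemma Zp_mult_closed:
  "0 < p \<Longrightarrow> x \<in> carrier (Zp p) \<Longrightarrow> y \<in> carrier (Zp p) \<Longrightarrow> mult (Zp p) x y \<in> carrier (Zp p)"
  unfolding Zp_simps
  by (rule Zp_closedI[where g = "\<lambda>k. x k * y k"]) (auto intro!: mod_mult_cong simp del: Zp_mod simp: Zp_cong)

lemma Zp_neg_closed:
  "0 < p \<Longrightarrow> x \<in> carrier (Zp p) \<Longrightarrow> (\<lambda>k. (- x k) mod int p ^ k) \<in> carrier (Zp p)"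
  by (rule Zp_closedI[where g = "\<lambda>k. - x k"]) (auto intro!: mod_minus_cong simp del: Zp_mod simp: Zp_cong)

lemma Zp_cring:
  assumes p: "0 < p" shows "cring (Zp p)"
proof (rule cringI)
  show "abelian_group (Zp p)"
  proof (rule abelian_groupI)
    show "\<zero>\<^bsub>Zp p\<^esub> \<in> carrier (Zp p)" using p by (simp add: Zp_carrier_iff Zp_simps)
    fix x y assume x: "x \<in> carrier (Zp p)" and y: "y \<in> carrier (Zp p)"
    show "x \<oplus>\<^bsub>Zp p\<^esub> y \<in> carrier (Zp p)" using Zp_add_closed[OF p x y] .
    show "\<zero>\<^bsub>Zp p\<^esub> \<oplus>\<^bsub>Zp p\<^esub> x = x" using x by (simp add: Zp_simps)
    show "x \<oplus>\<^bsub>Zp p\<^esub> y = y \<oplus>\<^bsub>Zp p\<^esub> x" by (simp add: Zp_simps add.commute)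
    show "\<exists>y\<in>carrier (Zp p). y \<oplus>\<^bsub>Zp p\<^esub> x = \<zero>\<^bsub>Zp p\<^esub>"
      by (rule bexI[OF _ Zp_neg_closed[OF p x]]) (simp add: Zp_simps mod_simps)
    fix z
    show "x \<oplus>\<^bsub>Zp p\<^esub> y \<oplus>\<^bsub>Zp p\<^esub> z = x \<oplus>\<^bsub>Zp p\<^esub> (y \<oplus>\<^bsub>Zp p\<^esub> z)"
      by (simp add: Zp_simps mod_simps add.assoc)
  qed
  show "Group.comm_monoid (Zp p)"
  proof (rule comm_monoidI)
    show "\<one>\<^bsub>Zp p\<^esub> \<in> carrier (Zp p)" unfolding Zp_simps by (rule Zp_closedI[OF p]) simp
    fix x y assume x: "x \<in> carrier (Zp p)" and y: "y \<in> carrier (Zp p)"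
    show "x \<otimes>\<^bsub>Zp p\<^esub> y \<in> carrier (Zp p)" using Zp_mult_closed[OF p x y] .
    show "\<one>\<^bsub>Zp p\<^esub> \<otimes>\<^bsub>Zp p\<^esub> x = x" using x by (simp add: Zp_simps mod_simps)
    show "x \<otimes>\<^bsub>Zp p\<^esub> y = y \<otimes>\<^bsub>Zp p\<^esub> x" by (simp add: Zp_simps mult.commute)
    fix z
    show "x \<otimes>\<^bsub>Zp p\<^esub> y \<otimes>\<^bsub>Zp p\<^esub> z = x \<otimes>\<^bsub>Zp p\<^esub> (y \<otimes>\<^bsub>Zp p\<^esub> z)"
      by (simp add: Zp_simps mod_simps mult.assoc)
  qed
  fix x y z
  show "(x \<oplus>\<^bsub>Zp p\<^esub> y) \<otimes>\<^bsub>Zp p\<^esub> z = x \<otimes>\<^bsub>Zp p\<^esub> z \<oplus>\<^bsub>Zp p\<^esub> y \<otimes>\<^bsub>Zp p\<^esub> z"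
    by (simp add: Zp_simps mod_simps ring_distribs)
qed

lemma Zp_minus:
  assumes p: "0 < p" and x: "x \<in> carrier (Zp p)" and y: "y \<in> carrier (Zp p)"
  shows "x \<ominus>\<^bsub>Zp p\<^esub> y = (\<lambda>k. (x k - y k) mod int p ^ k)"
proof -
  interpret cring "Zp p" by (rule Zp_cring[OF p])
  have "(\<lambda>k. (- y k) mod int p ^ k) \<oplus>\<^bsub>Zp p\<^esub> y = \<zero>\<^bsub>Zp p\<^esub>"
    by (simp add: Zp_simps mod_simps)
  then have "\<ominus>\<^bsub>Zp p\<^esub> y = (\<lambda>k. (- y k) mod int p ^ k)"
    using minus_equality y Zp_neg_closed[OF p y] by blast
  then show ?thesis by (simp add: a_minus_def Zp_simps mod_simps)
qed

lemma Zp_mod_le: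
  assumes x: "x \<in> carrier (Zp p)" and "j \<le> k"
  shows "x k mod int p ^ j = x j"
  using \<open>j \<le> k\<close>
proof (induction k rule: dec_induct)
  case base then show ?case using x by simp
next
  case (step k)
  have "x (Suc k) mod int p ^ j = x (Suc k) mod int p ^ k mod int p ^ j"
    using step by (simp add: mod_mod_cancel le_imp_power_dvd)
  also have "\<dots> = x k mod int p ^ j" using x by (simp add: Zp_carrier_iff)
  finally show ?case using step by simp
qed

lemma padic_abs_le_iff:
  assumes p: "2 \<le> p" and x: "x \<in> carrier (Zp p)"
  shows "padic_abs p x \<le> 1 / real p ^ k \<longleftrightarrow> x k = 0"
proof (cases "x = \<zero>\<^bsub>Zp p\<^esub>")
  case True then show ?thesis by (simp add: padic_abs_def Zp_simps)
next
  case False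
  then obtain l where l: "x l \<noteq> 0" by (auto simp: Zp_simps)
  have mono: "x i = 0" if "x j = 0" "i \<le> j" for i j
    using Zp_mod_le[OF x \<open>i \<le> j\<close>] that by simp
  have bd: "j \<le> l" if "x j = 0" for j using mono[OF that] l by (meson nat_le_linear)
  have x0: "x 0 = 0" using Zp_mod[OF x, of 0] by simp
  let ?v = "GREATEST k. x k = 0"
  have v0: "x ?v = 0" by (rule GreatestI_nat[where P="\<lambda>j. x j = 0", OF x0]) (use bd in blast)
  have vge: "x j = 0 \<Longrightarrow> j \<le> ?v" for j
    by (rule Greatest_le_nat[where P="\<lambda>j. x j = 0"]) (use bd in blast)+
  have "padic_abs p x \<le> 1 / real p ^ k \<longleftrightarrow> real p ^ k \<le> real p ^ ?v"
    using False p by (simp add: padic_abs_def field_simps)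
  also have "\<dots> \<longleftrightarrow> k \<le> ?v" using p by simp
  also have "\<dots> \<longleftrightarrow> x k = 0" using mono[OF v0] vge by blast
  finally show ?thesis .
qed

lemma closed_disk_eq:
  assumes p: "2 \<le> p" and a: "a \<in> carrier (Zp p)"
  shows "closed_disk p a (1 / real p ^ k) = {x \<in> carrier (Zp p). x k = a k}"
proof -
  have "padic_abs p (x \<ominus>\<^bsub>Zp p\<^esub> a) \<le> 1 / real p ^ k \<longleftrightarrow> x k = a k" if x: "x \<in> carrier (Zp p)" for x
  proof -
    interpret cring "Zp p" by (rule Zp_cring) (use p in simp)
    have "padic_abs p (x \<ominus>\<^bsub>Zp p\<^esub> a) \<le> 1 / real p ^ k \<longleftrightarrow> (x k - a k) mod int p ^ k = 0"
      using padic_abs_le_iff[OF p minus_closed[OF x a]] Zp_minus[OF _ x a] p by simp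
    also have "\<dots> \<longleftrightarrow> x k mod int p ^ k = a k mod int p ^ k"
      by (simp add: mod_eq_dvd_iff dvd_eq_mod_eq_0)
    finally show ?thesis using x a by simp
  qed
  then show ?thesis by (auto simp: closed_disk_def)
qed

lemma tree_root_eq: "2 \<le> p \<Longrightarrow> tree_root p = carrier (Zp p)"
proof -
  assume p: "2 \<le> p"
  have z: "\<zero>\<^bsub>Zp p\<^esub> \<in> carrier (Zp p)" using p by (simp add: Zp_carrier_iff Zp_simps)
  have "x 0 = 0" if "x \<in> carrier (Zp p)" for x using Zp_mod[OF that, of 0] by simp
  then show ?thesis using closed_disk_eq[OF p z, of 0] by (auto simp: tree_root_def Zp_simps)
qed

lemma levels_disjoint:
  assumes p: "2 \<le> p" and v: "v \<in> level p j" "v \<in> level p k"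
  shows "j = k"
proof -
  have False if lt: "j < k" and v: "v \<in> level p j" "v \<in> level p k" for j k
  proof -
    obtain a b where a: "a \<in> carrier (Zp p)" and b: "b \<in> carrier (Zp p)"
      and va: "v = {x \<in> carrier (Zp p). x j = a j}" and vb: "v = {x \<in> carrier (Zp p). x k = b k}"
      using v closed_disk_eq[OF p] unfolding level_def by blast
    define q where "q = (\<lambda>i. int p ^ j mod int p ^ i)"
    have q: "q \<in> carrier (Zp p)" unfolding q_def by (rule Zp_closedI) (use p in auto)
    have s: "a \<oplus>\<^bsub>Zp p\<^esub> q \<in> carrier (Zp p)" by (rule Zp_add_closed) (use p a q in auto)
    have "(a \<oplus>\<^bsub>Zp p\<^esub> q) j = a j" using a by (simp add: Zp_simps q_def mod_simps)
    then have "a \<oplus>\<^bsub>Zp p\<^esub> q \<in> v" "a \<in> v" using va s a by auto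
    then have "(a \<oplus>\<^bsub>Zp p\<^esub> q) k = a k" using vb by simp
    then have "(a k + int p ^ j) mod int p ^ k = a k mod int p ^ k"
      using a by (simp add: Zp_simps q_def mod_simps)
    then have "int p ^ k dvd int p ^ j" by (simp add: mod_eq_dvd_iff)
    then have "p ^ k dvd p ^ j" by (metis of_nat_dvd_iff of_nat_power)
    then have "k \<le> j" using p by (intro power_dvd_imp_le[of p]) auto
    then show False using lt by simp
  qed
  then show ?thesis using v by (metis nat_neq_iff)
qed

lemma quad_map_eq:
  "z \<in> carrier (Zp p) \<Longrightarrow> 0 < p \<Longrightarrow> quad_map p c z = (\<lambda>k. ((z k)\<^sup>2 + c k) mod int p ^ k)"
proof -
  assume z: "z \<in> carrier (Zp p)" and p: "0 < p"
  interpret cring "Zp p" by (rule Zp_cring[OF p])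
  have "z [^]\<^bsub>Zp p\<^esub> (2::nat) = z \<otimes>\<^bsub>Zp p\<^esub> z" using z by (simp add: numeral_2_eq_2)
  then show ?thesis by (simp add: quad_map_def Zp_simps power2_eq_square mod_simps)
qed

lemma quad_map_closed:
  assumes "0 < p" "c \<in> carrier (Zp p)" "z \<in> carrier (Zp p)"
  shows "quad_map p c z \<in> carrier (Zp p)"
proof -
  interpret cring "Zp p" by (rule Zp_cring) fact
  show ?thesis using assms by (simp add: quad_map_def)
qed

lemma vertex_map_closed_disk:
  assumes p: "2 \<le> p" and c: "c \<in> carrier (Zp p)" and a: "a \<in> carrier (Zp p)"
  shows "vertex_map p c (closed_disk p a (1 / real p ^ k)) =
         closed_disk p (quad_map p c a) (1 / real p ^ k)"
proof -
  let ?v = "closed_disk p a (1 / real p ^ k)"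
  let ?w = "closed_disk p (quad_map p c a) (1 / real p ^ k)"
  have p0: "0 < p" using p by simp
  have fa: "quad_map p c a \<in> carrier (Zp p)" by (rule quad_map_closed[OF p0 c a])
  have v: "?v \<in> level p k" and w: "?w \<in> level p k" using a fa by (auto simp: level_def)
  have sub: "quad_map p c ` ?v \<subseteq> ?w"
    using quad_map_closed[OF p0 c] quad_map_eq[OF _ p0] a
    by (auto simp: closed_disk_eq[OF p] fa)
  have av: "a \<in> ?v" using a by (simp add: closed_disk_eq[OF p])
  show ?thesis unfolding vertex_map_def
  proof (rule the_equality)
    show "\<exists>j. ?v \<in> level p j \<and> ?w \<in> level p j \<and> quad_map p c ` ?v \<subseteq> ?w"
      using v w sub by blast
    fix u assume "\<exists>j. ?v \<in> level p j \<and> u \<in> level p j \<and> quad_map p c ` ?v \<subseteq> u"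
    then have u: "u \<in> level p k" and "quad_map p c a \<in> u"
      using levels_disjoint[OF p v] av by auto
    then show "u = ?w" by (auto simp: level_def closed_disk_eq[OF p] fa)
  qed
qed

lemma critical_orbit_closed:
  assumes "0 < p" "c \<in> carrier (Zp p)" "x \<in> critical_orbit p c"
  shows "x \<in> carrier (Zp p)"
proof -
  have "(quad_map p c ^^ i) \<zero>\<^bsub>Zp p\<^esub> \<in> carrier (Zp p)" for i
    by (induction i) (use assms quad_map_closed in \<open>auto simp: Zp_carrier_iff Zp_simps\<close>)
  then show ?thesis using assms by (auto simp: critical_orbit_def)
qed

lemma coincides_mod_iff:
  assumes p: "2 \<le> p" and c: "c \<in> carrier (Zp p)"
  shows "coincides_mod p c \<longleftrightarrow> trimmed_critical_orbit_tree p c = critical_orbit_tree_mod p c"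
proof -
  define CO where "CO = critical_orbit p c"
  define D where "D x k = closed_disk p x (1 / real p ^ k)" for x k
  define VV where "VV = pverts (critical_orbit_tree p c)"
  define TT where "TT = pverts (trimmed_critical_orbit_tree p c)"
  define MM where "MM = pverts (critical_orbit_tree_mod p c)"
  note defs = CO_def VV_def TT_def MM_def D_def
  have O: "x \<in> carrier (Zp p)" if "x \<in> CO" for x
    using critical_orbit_closed[OF _ c, of x] p that by (simp add: CO_def)
  have V: "v \<in> VV \<longleftrightarrow> (\<exists>x\<in>CO. \<exists>k. v = D x k)" for v
    by (auto simp: defs critical_orbit_tree_def induced_def path_to_def)
  have DE: "D x k = {y \<in> carrier (Zp p). y k = x k}" if "x \<in> carrier (Zp p)" for x k
    using closed_disk_eq[OF p that] by (simp add: D_def)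
  have T: "v \<in> TT \<longleftrightarrow> v \<in> VV \<and> (\<forall>w\<in>VV. v \<subset> w \<and> w \<noteq> tree_root p \<longrightarrow>
             (\<exists>x\<in>w \<inter> CO. \<exists>y\<in>w \<inter> CO. x \<noteq> y))" for v
    by (simp add: defs trimmed_critical_orbit_tree_def induced_def)
  have M: "v \<in> MM \<longleftrightarrow> v = tree_root p \<or> v \<in> VV \<and> v \<in> level p 1" for v
    by (simp add: defs critical_orbit_tree_mod_def induced_def)
  have lev: "D x k \<in> level p k" if "x \<in> CO" for x k
    using O[OF that] by (auto simp: level_def D_def)
  have root0: "D x 0 = tree_root p" if "x \<in> CO" for x
  proof -
    have y0: "y 0 = 0" if "y \<in> carrier (Zp p)" for y using Zp_mod[OF that, of 0] by simp
    show ?thesis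
      using O[OF that] unfolding DE[OF O[OF that]] tree_root_eq[OF p] by (auto simp: y0)
  qed
  have z: "\<zero>\<^bsub>Zp p\<^esub> \<in> CO" by (auto simp: CO_def critical_orbit_def intro: exI[of _ 0])
  have lev0: "tree_root p \<in> level p 0" using lev[OF z, of 0] unfolding root0[OF z] .
  have mem: "x \<in> D x k" if "x \<in> CO" for x k
    using O[OF that] by (simp add: DE)
  have anti: "D x k \<subseteq> D x j" if "x \<in> CO" "j \<le> k" for x j k
    using Zp_mod_le[OF _ \<open>j \<le> k\<close>, of _ p] O[OF that(1)]
    by (auto simp: DE[OF O[OF that(1)]]) metis
  have anc: "j < k \<or> D x k = D y j" if "x \<in> CO" "y \<in> CO" "D x k \<subseteq> D y j" for x y j k
  proof (rule disjCI)
    assume "D x k \<noteq> D y j"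
    moreover have "x \<in> D y j" using mem[OF that(1), of k] that(3) by blast
    then have "D y j = D x j" using O that(1,2) by (auto simp: DE)
    ultimately show "j < k" using anti[OF that(1), of k j] that(3) by (metis not_le subset_antisym)
  qed
  have eq: "trimmed_critical_orbit_tree p c = critical_orbit_tree_mod p c \<longleftrightarrow> TT = MM"
    by (auto simp: defs trimmed_critical_orbit_tree_def critical_orbit_tree_mod_def induced_def)
  have TM: "v \<in> TT" if "v \<in> MM" for v
  proof -
    obtain x k where x: "x \<in> CO" "v = D x k" and k: "k \<le> 1"
    proof (cases "v = tree_root p")
      case True
      then have "v = D \<zero>\<^bsub>Zp p\<^esub> 0" using root0[OF z] by (rule trans[OF _ sym])
      then show ?thesis by (rule that[OF z]) simp
    next
      case False
      then have vV: "v \<in> VV" and v1: "v \<in> level p 1" using \<open>v \<in> MM\<close> unfolding M by simp_all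
      obtain x k where x: "x \<in> CO" "v = D x k" using vV unfolding V by (elim bexE exE)
      have "k = 1" by (rule levels_disjoint[OF p lev[OF x(1)] v1[unfolded x(2)]])
      then show ?thesis using that[OF x] by simp
    qed
    show ?thesis unfolding T
    proof (intro conjI ballI impI)
      show "v \<in> VV" unfolding V x(2) using x(1) by (intro bexI exI) (rule refl)
      fix w assume "w \<in> VV" and vw: "v \<subset> w \<and> w \<noteq> tree_root p"
      then obtain y j where y: "y \<in> CO" "w = D y j" unfolding V by (elim bexE exE)
      then have "j < k" using anc[OF x(1) y(1), of k j] vw unfolding x(2) y(2) by (simp add: less_le)
      then have "j = 0" using k by simp
      have "w = tree_root p" unfolding y(2) \<open>j = 0\<close> by (rule root0[OF y(1)])
      then show "\<exists>x\<in>w \<inter> CO. \<exists>y\<in>w \<inter> CO. x \<noteq> y" using vw by simp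
    qed
  qed
  show ?thesis
  proof
    assume co: "coincides_mod p c"
    have "v \<in> MM" if "v \<in> TT" for v
    proof (rule ccontr)
      assume nM: "v \<notin> MM"
      have vV: "v \<in> VV" using that unfolding T by (rule conjunct1)
      then obtain x k where x: "x \<in> CO" "v = D x k" unfolding V by (elim bexE exE)
      have "k \<noteq> 0"
      proof
        assume "k = 0"
        then have "v = tree_root p" using root0[OF x(1)] x(2) by simp
        then show False using nM unfolding M by simp
      qed
      moreover have "k \<noteq> 1"
      proof
        assume "k = 1"
        then have "v \<in> level p 1" using lev[OF x(1), of 1] x(2) by simp
        then show False using nM vV unfolding M by simp
      qed
      ultimately have k: "1 \<le> k" "k \<noteq> 1" by auto
      have D1: "D x 1 \<in> VV" unfolding V using x(1) by (intro bexI exI) (rule refl)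
      have "D x 1 \<noteq> tree_root p"
      proof
        assume "D x 1 = tree_root p"
        then have "D x 1 \<in> level p 0" using lev0 by simp
        then show False using levels_disjoint[OF p _ lev[OF x(1)]] by fastforce
      qed
      moreover have "v \<subset> D x 1"
      proof (rule psubsetI)
        show "v \<subseteq> D x 1" unfolding x(2) by (rule anti[OF x(1) k(1)])
        show "v \<noteq> D x 1"
        proof
          assume "v = D x 1"
          then have "v \<in> level p 1" using lev[OF x(1)] by simp
          then show False using levels_disjoint[OF p lev[OF x(1)], of k 1] k(2) x(2) by simp
        qed
      qed
      ultimately have "\<exists>a\<in>D x 1 \<inter> CO. \<exists>b\<in>D x 1 \<inter> CO. a \<noteq> b" 
        using that D1 unfolding T by (elim conjE) (drule (1) bspec, simp)
      moreover have "\<forall>a\<in>D x 1 \<inter> CO. \<forall>b\<in>D x 1 \<inter> CO. a = b"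
        using co lev[OF x(1), of 1] unfolding coincides_mod_def CO_def by (rule bspec)
      ultimately show False by simp
    qed
    then show "trimmed_critical_orbit_tree p c = critical_orbit_tree_mod p c"
      unfolding eq using TM by (intro subset_antisym subsetI)
  next
    assume "trimmed_critical_orbit_tree p c = critical_orbit_tree_mod p c"
    then have TMeq: "TT = MM" unfolding TT_def MM_def by simp
    show "coincides_mod p c" unfolding coincides_mod_def CO_def[symmetric]
    proof (intro ballI, rule ccontr)
      fix v x y assume v: "v \<in> level p 1" and x: "x \<in> v \<inter> CO" and y: "y \<in> v \<inter> CO" and ne: "x \<noteq> y"
      have xO: "x \<in> CO" using x by simp
      obtain a where a: "a \<in> carrier (Zp p)" "v = D a 1" using v unfolding level_def D_def by blast
      have "x 1 = a 1" using x unfolding a(2) DE[OF a(1)] by simp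
      then have vx: "v = D x 1"
        unfolding a(2) DE[OF a(1)] DE[OF O[OF xO]] by simp
      have "D x 2 \<in> TT" unfolding T
      proof (intro conjI ballI impI)
        show "D x 2 \<in> VV" unfolding V using xO by (intro bexI exI) (rule refl)
        fix w assume "w \<in> VV" and w: "D x 2 \<subset> w \<and> w \<noteq> tree_root p"
        then obtain u j where u: "u \<in> CO" "w = D u j" unfolding V by (elim bexE exE)
        then have "j < 2" using anc[OF xO u(1), of 2 j] w unfolding u(2) by (simp add: less_le)
        moreover have "j \<noteq> 0" 
        proof
          assume "j = 0"
          then show False using root0[OF u(1)] u(2) w by simp
        qed
        ultimately have "j = 1" by simp
        moreover have "x \<in> w" using mem[OF xO, of 2] w by blast
        ultimately have wu: "w = D u 1" and xu: "x \<in> D u 1" using u(2) by simp_all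
        have "x 1 = u 1" using xu unfolding DE[OF O[OF u(1)]] by simp
        then have "w = v"
          unfolding wu vx DE[OF O[OF u(1)]] DE[OF O[OF xO]] by simp
        then show "\<exists>x\<in>w \<inter> CO. \<exists>y\<in>w \<inter> CO. x \<noteq> y" 
          using x y ne by (intro bexI[of _ x] bexI[of _ y]) simp_all
      qed
      then have "D x 2 = tree_root p \<or> D x 2 \<in> level p 1" unfolding TMeq M by (elim disjE conjE) simp_all
      then show False
      proof
        assume "D x 2 = tree_root p"
        then have "D x 2 \<in> level p 0" using lev0 by simp
        then show False using levels_disjoint[OF p lev[OF xO], of 2 0] by simp
      next
        assume "D x 2 \<in> level p 1"
        then show False using levels_disjoint[OF p lev[OF xO], of 2 1] by simp
      qed
    qed
  qed
qed

end

theory Submission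
  imports Defs "HOL-Number_Theory.Residues"
begin

text \<open>
  Write \<open>x i\<close> for the \<open>i\<close>-th point of the critical orbit and \<open>v\<close> for the p-adic valuation. Everything
  rests on the identity \<open>f u - f w = (u - w) * (u + w)\<close>. If \<open>u\<close> and \<open>w\<close> are congruent modulo \<open>p\<close>, then
  \<open>u + w\<close> is congruent to \<open>2 * u\<close>; so \<open>f\<close> contracts distances in the residue class of \<open>0\<close> and, \<open>p\<close>
  being odd, preserves them in every other class.

  Suppose first that the orbit comes back to the class of \<open>0\<close>, for the first time at \<open>x d\<close>, and that
  \<open>x d\<close> is not \<open>0\<close>. Following the points \<open>x (j * d)\<close> gives \<open>v (x ((j + 1) * d) - x (j * d)) =
  (j + 1) * v (x d)\<close> (lemma \<open>multiplicity_critical_return\<close>), so that these consecutive points are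
  distinct but arbitrarily close, which a finite orbit forbids. Hence \<open>0\<close> is periodic as soon as it
  is periodic modulo \<open>p\<close>. If \<open>0\<close> is periodic, two orbit points in a common class can be moved forward
  until one of them is \<open>0\<close>, and the same argument shows that they are equal. This gives the
  periodic case.

  Suppose now that \<open>0\<close> is strictly preperiodic of type \<open>(m, n)\<close>. Then no later point lies in the
  class of \<open>0\<close>. As \<open>x (m - 1)\<close> and \<open>x (m + n - 1)\<close> are different points with the same image, they
  are opposite units, and so incongruent; it follows that each tail point \<open>x i\<close>, \<open>i < m\<close>, is alone in
  its class and that this class is not periodic. On the cycle, let \<open>d\<close> be the period modulo \<open>p\<close>, let
  \<open>k = v (x (m + d) - x m)\<close>, and let \<open>M\<close> be the derivative of \<open>f ^^ d\<close> at \<open>x m\<close>, a unit. Modulo \<open>p\<close>, the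
  quotient of \<open>x (m + t * d) - x m\<close> by \<open>x (m + d) - x m\<close> is the geometric sum \<open>1 + M + \<dots> + M ^ (t - 1)\<close>.
  Let \<open>r\<close> be the least positive \<open>t\<close> for which \<open>p\<close> divides it. Before time \<open>r\<close> all returns differ from
  \<open>x m\<close> by valuation exactly \<open>k\<close>. At time \<open>r\<close> the difference is divisible by \<open>p ^ (k + 1)\<close>, hence by
  \<open>p\<^sup>2\<close>, while \<open>M ^ r\<close> is \<open>1\<close> modulo \<open>p\<close>. If it were not zero, then its valuation would grow by exactly
  one with each further \<open>p\<close>-fold return (lemma \<open>multiplicity_return\<close>), again contradicting finiteness.
  So \<open>n = r * d\<close>, and each periodic class contains \<open>r\<close> points at the common mutual distance
  \<open>p ^ (- k)\<close>: the tree has no branching below level \<open>1\<close> if \<open>r = 1\<close>, and one instance of branching at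
  level \<open>k\<close> otherwise.

  The valuations are computed in the integers: modulo \<open>p ^ K\<close> the critical orbit is the orbit of \<open>0\<close>
  under \<open>z\<^sup>2 + C\<close> for an integer \<open>C\<close> (lemma \<open>integer_lift\<close>), for which the identity above holds
  exactly. Finiteness of the orbit becomes the statement that congruence modulo some \<open>p ^ K\<close> already
  implies equality (lemma \<open>separating_level\<close>), hence congruence modulo every higher power.
\<close>

section \<open>Integer sequences generated by a quadratic polynomial\<close>

locale quadratic_sequence =
  fixes s :: "nat \<Rightarrow> int" and C :: int
  assumes step: "s (Suc i) = (s i)\<^sup>2 + C"
begin

lemma difference_shift:
  "s (i + t) - s (j + t) = (s i - s j) * (\<Prod>l<t. s (i + l) + s (j + l))"
proof (induction t)
  case (Suc t)
  have "s (i + Suc t) - s (j + Suc t) = (s (i + t) - s (j + t)) * (s (i + t) + s (j + t))"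
    by (simp add: step power2_eq_square algebra_simps)
  also have "\<dots> = (s i - s j) * (\<Prod>l<Suc t. s (i + l) + s (j + l))"
    by (simp add: Suc mult.assoc)
  finally show ?case .
qed simp

lemma dvd_shift: "a dvd s i - s j \<Longrightarrow> a dvd s (i + t) - s (j + t)"
  unfolding difference_shift by simp

lemma dvd_return: "a dvd s (i + d) - s i \<Longrightarrow> a dvd s (i + t * d) - s i"
proof (induction t)
  case (Suc t)
  have "a dvd s (i + t * d + d) - s (i + d)"
    using dvd_shift[OF Suc.IH[OF Suc.prems], of d] .
  from dvd_add[OF this Suc.prems] show ?case by (simp add: algebra_simps)
qed simp

text \<open>
  The derivative of the \<open>d\<close>-th iterate of \<open>z\<^sup>2 + C\<close> at \<open>s 0\<close>, by the chain rule.
\<close>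

definition multiplier :: "nat \<Rightarrow> int" where
  "multiplier d = (\<Prod>l<d. 2 * s l)"

lemma multiplier_cong:
  assumes "a dvd s i - s 0"
  shows "[(\<Prod>l<d. s (i + l) + s l) = multiplier d] (mod a)"
  unfolding multiplier_def
proof (rule cong_prod)
  fix l
  have "a dvd s (i + l) - s (0 + l)" by (rule dvd_shift[OF assms])
  then show "[s (i + l) + s l = 2 * s l] (mod a)"
    by (simp add: cong_iff_dvd_diff)
qed

lemma multiplier_power_cong:
  assumes "a dvd s d - s 0"
  shows "[multiplier (t * d) = multiplier d ^ t] (mod a)"
proof (induction t)
  case (Suc t)
  have "multiplier (i + d) = multiplier i * (\<Prod>l<d. 2 * s (i + l))" for i
    unfolding multiplier_def by (induction d) (simp_all add: mult_ac)
  from this[of "t * d"]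
  have "multiplier (Suc t * d) = multiplier (t * d) * (\<Prod>l<d. 2 * s (t * d + l))"
    by (simp add: add.commute)
  moreover have "[(\<Prod>l<d. 2 * s (t * d + l)) = multiplier d] (mod a)"
    unfolding multiplier_def
  proof (rule cong_prod)
    fix l
    have "a dvd s (0 + t * d) - s 0" using dvd_return[of a 0 d] assms by simp
    from dvd_shift[OF this, of l] show "[2 * s (t * d + l) = 2 * s l] (mod a)"
      by (intro cong_mult) (simp_all add: cong_iff_dvd_diff)
  qed
  ultimately show ?case using cong_mult[OF Suc] by (metis power_Suc2)
qed (simp add: multiplier_def)

text \<open>
  To first order, an iterate with multiplier \<open>M\<close> acts near \<open>s 0\<close> as an affine map, so displacements
  add up to a geometric sum. The induction is Horner's scheme: advancing by \<open>d\<close> multiplies the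
  displacement so far by a number congruent to \<open>M\<close> and adds the first displacement.
\<close>

lemma return_difference:
  assumes "a dvd s d - s 0"
  obtains T where "s (t * d) - s 0 = (s d - s 0) * T" "[T = (\<Sum>j<t. multiplier d ^ j)] (mod a)"
proof -
  have "\<exists>T. s (t * d) - s 0 = (s d - s 0) * T \<and> [T = (\<Sum>j<t. multiplier d ^ j)] (mod a)"
  proof (induction t)
    case 0
    show ?case by (rule exI[of _ 0]) simp
  next
    case (Suc t)
    then obtain T where T: "s (t * d) - s 0 = (s d - s 0) * T"
      "[T = (\<Sum>j<t. multiplier d ^ j)] (mod a)" by blast
    define P where "P = (\<Prod>l<d. s (t * d + l) + s l)"
    have "s (Suc t * d) - s 0 = (s (t * d + d) - s (0 + d)) + (s d - s 0)"
      by (simp add: add.commute)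
    also have "\<dots> = (s d - s 0) * (P * T + 1)"
      by (simp only: difference_shift T(1)) (simp add: P_def algebra_simps)
    finally have "s (Suc t * d) - s 0 = (s d - s 0) * (P * T + 1)" .
    moreover have "[P = multiplier d] (mod a)"
      unfolding P_def using multiplier_cong dvd_return[of a 0 d t] assms by simp
    then have "[P * T + 1 = multiplier d * (\<Sum>j<t. multiplier d ^ j) + 1] (mod a)"
      by (intro cong_add cong_mult T(2) cong_refl)
    moreover have "multiplier d * (\<Sum>j<t. multiplier d ^ j) + 1 = (\<Sum>j<Suc t. multiplier d ^ j)"
      by (simp only: sum.lessThan_Suc_shift) (simp add: sum_distrib_left)
    ultimately show ?case by metis
  qed
  with that show thesis by blast
qed

end

lemma odd_prime_not_dvd_two:
  assumes "prime p" "odd p"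
  shows "\<not> int p dvd 2"
proof
  assume "int p dvd 2"
  then have "int p dvd int 2" by simp
  then have "p dvd 2" by (simp only: int_dvd_int_iff)
  then have "p = 2" using \<open>prime p\<close> two_is_prime_nat by (rule primes_dvd_imp_eq[rotated 2])
  with \<open>odd p\<close> show False by simp
qed

lemma fermat_little_int:
  assumes "prime p" "\<not> int p dvd a"
  shows "[a ^ (p - 1) = 1] (mod int p)"
proof -
  define b where "b = nat (a mod int p)"
  have b: "int b = a mod int p" using prime_gt_0_nat[OF \<open>prime p\<close>] by (simp add: b_def)
  then have ab: "[a = int b] (mod int p)" by (simp add: cong_def)
  have "\<not> int p dvd int b" using cong_dvd_iff[OF ab] assms(2) by simp
  then have "[b ^ (p - 1) = 1] (mod p)"
    by (intro fermat_theorem[OF \<open>prime p\<close>]) simp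
  then have "[int b ^ (p - 1) = 1] (mod int p)"
    using cong_int_iff[of "b ^ (p - 1)" 1 p] by simp
  with cong_pow[OF ab] show ?thesis by (rule cong_trans)
qed

text \<open>
  With \<open>M = 1 + p * w\<close>, the binomial theorem gives \<open>M ^ j \<equiv> 1 + j * p * w\<close>, and the sum of the linear
  terms is \<open>p * w * (p * (p - 1) / 2)\<close>. For odd \<open>p\<close> this is a multiple of \<open>p\<^sup>2\<close>; for \<open>p = 2\<close> it need
  not be.
\<close>

lemma geometric_sum_cong_odd:
  assumes "odd p" and M: "[M = 1] (mod int p)"
  shows "[(\<Sum>j<p. M ^ j) = int p] (mod (int p)\<^sup>2)"
proof -
  have sq: "(int p)\<^sup>2 dvd (M - 1)\<^sup>2"
    using M by (simp add: cong_iff_dvd_diff dvd_power_same)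
  have pow: "[M ^ j = 1 + int j * (M - 1)] (mod (int p)\<^sup>2)" for j
  proof (induction j)
    case (Suc j)
    have "[M * M ^ j = M * (1 + int j * (M - 1))] (mod (int p)\<^sup>2)"
      by (rule cong_mult[OF cong_refl Suc])
    moreover have "M * (1 + int j * (M - 1)) - (1 + int (Suc j) * (M - 1)) = int j * (M - 1)\<^sup>2"
      by (simp add: power2_eq_square algebra_simps)
    then have "[M * (1 + int j * (M - 1)) = 1 + int (Suc j) * (M - 1)] (mod (int p)\<^sup>2)"
      using sq by (simp add: cong_iff_dvd_diff)
    ultimately show ?case by (auto intro: cong_trans)
  qed simp
  obtain q where q: "p = 2 * q + 1" using \<open>odd p\<close> by (elim oddE)
  have "(\<Sum>j<2 * q + 1. int j) = int (2 * q + 1) * int q"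
    by (induction q) (simp_all add: algebra_simps)
  then have "(\<Sum>j<p. 1 + int j * (M - 1)) = int p + int p * int q * (M - 1)"
    using q by (simp add: sum.distrib flip: sum_distrib_right)
  moreover have "(int p)\<^sup>2 dvd int p * int q * (M - 1)"
    using M by (auto simp: cong_iff_dvd_diff power2_eq_square)
  ultimately have "[(\<Sum>j<p. 1 + int j * (M - 1)) = int p] (mod (int p)\<^sup>2)"
    by (simp add: cong_iff_dvd_diff)
  with cong_sum[of "{..<p}", OF pow] show ?thesis by (rule cong_trans)
qed

context quadratic_sequence
begin

text \<open>
  An orbit that returns close to its starting point with multiplier \<open>1\<close> modulo \<open>p\<close> behaves like a
  translation: a \<open>p\<close>-fold return multiplies the displacement by \<open>p\<close> times a unit. Closeness is needed
  modulo \<open>p\<^sup>2\<close>, since the geometric sum has to be known modulo \<open>p\<^sup>2\<close> for its valuation to be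
  exactly \<open>1\<close>.
\<close>

lemma multiplicity_return:
  assumes "prime p" "odd p" and d: "(int p)\<^sup>2 dvd s d - s 0" "s d \<noteq> s 0"
    and M: "[multiplier d = 1] (mod int p)"
  shows "s (p ^ j * d) \<noteq> s 0 \<and>
         multiplicity (int p) (s (p ^ j * d) - s 0) = multiplicity (int p) (s d - s 0) + j"
proof (induction j)
  case (Suc j)
  define e where "e = p ^ j * d"
  have P: "prime (int p)" using \<open>prime p\<close> by simp
  have e: "(int p)\<^sup>2 dvd s e - s 0"
    using dvd_return[of "(int p)\<^sup>2" 0 d] d(1) by (simp add: e_def)
  have "int p dvd s d - s 0" using d(1) by (rule dvd_trans[rotated]) (simp add: power2_eq_square)
  then have "[multiplier e = multiplier d ^ (p ^ j)] (mod int p)"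
    unfolding e_def by (rule multiplier_power_cong)
  moreover have "[multiplier d ^ (p ^ j) = 1] (mod int p)" using cong_pow[OF M] by simp
  ultimately have "[multiplier e = 1] (mod int p)" by (rule cong_trans)
  then have sum: "[(\<Sum>i<p. multiplier e ^ i) = int p] (mod (int p)\<^sup>2)"
    by (rule geometric_sum_cong_odd[OF \<open>odd p\<close>])
  obtain T where T: "s (p * e) - s 0 = (s e - s 0) * T" "[T = int p] (mod (int p)\<^sup>2)"
    using return_difference[OF e] cong_trans[OF _ sum] by blast
  obtain w where w: "T = int p * (1 + int p * w)"
  proof -
    from T(2) obtain w where "T - int p = (int p)\<^sup>2 * w"
      unfolding cong_iff_dvd_diff by (elim dvdE)
    then have "T = int p * (1 + int p * w)" by (simp add: power2_eq_square algebra_simps)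
    with that show thesis .
  qed
  have "\<not> int p dvd 1 + int p * w"
    using prime_gt_1_nat[OF \<open>prime p\<close>] by (simp add: dvd_add_left_iff)
  then have "\<not> int p ^ Suc 1 dvd T" using P by (simp add: w prime_gt_0_int)
  then have "multiplicity (int p) T = 1" "T \<noteq> 0"
    using w by (auto intro!: multiplicity_eqI)
  then show ?case
    using Suc T(1) P by (auto simp: e_def prime_elem_multiplicity_mult_distrib mult.assoc)
qed (use d(2) in simp)

text \<open>
  Passing from \<open>j\<close> to \<open>j + 1\<close> multiplies the difference by the sums \<open>s ((j + 1) * d + l) + s (j * d + l)\<close>
  with \<open>l < d\<close>. For \<open>l > 0\<close> these are units by minimality of \<open>d\<close>. For \<open>l = 0\<close> the valuation is that of
  \<open>s d\<close>: as \<open>0\<close> is a critical point, the \<open>d\<close>-th iterate sends every multiple of \<open>p ^ e\<close> to a point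
  congruent to \<open>s d\<close> modulo \<open>p ^ (2 * e)\<close>, where \<open>e\<close> is the valuation of \<open>s d\<close>, so all \<open>s (j * d)\<close> with \<open>j > 0\<close> agree with \<open>s d\<close> modulo \<open>p ^ (2 * e)\<close>.
\<close>

lemma multiplicity_critical_return:
  assumes "prime p" "odd p" "s 0 = 0" "0 < d" "s d \<noteq> 0"
    and pd: "int p dvd s d" and least: "\<And>i. 0 < i \<Longrightarrow> i < d \<Longrightarrow> \<not> int p dvd s i"
  shows "s (Suc j * d) \<noteq> s (j * d) \<and>
         multiplicity (int p) (s (Suc j * d) - s (j * d)) = Suc j * multiplicity (int p) (s d)"
proof -
  define e where "e = multiplicity (int p) (s d)"
  have P: "prime (int p)" using \<open>prime p\<close> by simp
  have nu: "\<not> is_unit (int p)" using prime_gt_1_nat[OF \<open>prime p\<close>] by simp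
  have p2: "\<not> int p dvd 2"
    by (rule odd_prime_not_dvd_two) fact+
  have e: "int p ^ e dvd s d" unfolding e_def by (rule multiplicity_dvd)
  have e': "\<not> int p ^ Suc e dvd s d"
    unfolding e_def using \<open>s d \<noteq> 0\<close> nu by (simp add: power_dvd_iff_le_multiplicity del: power_Suc)
  have "1 \<le> e" unfolding e_def
    using pd \<open>s d \<noteq> 0\<close> nu by (metis multiplicity_geI power_one_right)
  have near: "int p ^ (2 * e) dvd s (Suc j * d) - s d" for j
  proof (induction j)
    case (Suc j)
    have "int p ^ e dvd s (Suc j * d)"
      using dvd_add[OF dvd_trans[OF _ Suc] e] by (simp add: le_imp_power_dvd)
    then have sq: "int p ^ (2 * e) dvd s (Suc j * d) * s (Suc j * d)"
      unfolding mult_2 power_add by (rule mult_dvd_mono) fact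
    have "s (Suc (Suc j) * d) - s d = s (Suc j * d + d) - s (0 + d)"
      by (simp add: algebra_simps)
    also have "\<dots> = s (Suc j * d) * (\<Prod>l<d. s (Suc j * d + l) + s l)"
      by (simp only: difference_shift) (simp add: \<open>s 0 = 0\<close>)
    \<comment> \<open>The factor for \<open>l = 0\<close> supplies the second copy of \<open>s (Suc j * d)\<close>, because \<open>s 0 = 0\<close>.\<close>
    also have "(\<Prod>l<d. s (Suc j * d + l) + s l) =
        (s (Suc j * d)) * (\<Prod>l\<in>{..<d} - {0}. s (Suc j * d + l) + s l)"
      using \<open>0 < d\<close> \<open>s 0 = 0\<close> by (subst prod.remove[of _ 0]) auto
    finally show ?case using sq by (simp only: mult.assoc[symmetric] dvd_mult2)
  qed simp
  have sum: "s (Suc j * d) + s (j * d) \<noteq> 0 \<and>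
      multiplicity (int p) (s (Suc j * d) + s (j * d)) = e" for j
  proof (cases j)
    case 0
    then show ?thesis using assms by (simp add: e_def)
  next
    case (Suc i)
    have eq: "s (Suc j * d) + s (j * d) = (s (Suc j * d) - s d) + (s (Suc i * d) - s d) + 2 * s d"
      by (simp add: Suc)
    have div: "int p ^ (2 * e) dvd (s (Suc j * d) - s d) + (s (Suc i * d) - s d)"
      by (intro dvd_add near)
    have 1: "int p ^ e dvd s (Suc j * d) + s (j * d)" unfolding eq
      by (rule dvd_add[OF dvd_trans[OF _ div] dvd_mult[OF e]]) (simp add: le_imp_power_dvd)
    have 2: "\<not> int p ^ Suc e dvd s (Suc j * d) + s (j * d)"
    proof
      assume 2: "int p ^ Suc e dvd s (Suc j * d) + s (j * d)"
      have 3: "int p ^ Suc e dvd (s (Suc j * d) - s d) + (s (Suc i * d) - s d)"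
        using div by (rule dvd_trans[rotated]) (use \<open>1 \<le> e\<close> in \<open>simp add: le_imp_power_dvd del: power_Suc\<close>)
      have "int p ^ Suc e dvd 2 * s d" using dvd_diff[OF 2 3] unfolding eq by simp
      moreover have "coprime (int p ^ Suc e) 2"
        using prime_imp_coprime[OF P p2] by (simp only: coprime_power_left_iff simp_thms)
      ultimately show False using e' by (simp add: coprime_dvd_mult_right_iff)
    qed
    show ?thesis using 2 multiplicity_eqI[OF 1 2] by auto
  qed
  have unit: "\<not> int p dvd s (Suc j * d + l) + s (j * d + l)" if "0 < l" "l < d" for j l
  proof
    have "int p dvd s (0 + t * d) - s 0" for t
      by (rule dvd_return) (use pd \<open>s 0 = 0\<close> in simp)
    then have "int p dvd s (t * d + l) - s l" for t using dvd_shift[of _ "t * d" 0 l] by simp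
    then have 1: "int p dvd (s (Suc j * d + l) - s l) + (s (j * d + l) - s l)" by (intro dvd_add)
    assume 2: "int p dvd s (Suc j * d + l) + s (j * d + l)"
    have "int p dvd 2 * s l" using dvd_diff[OF 2 1] by simp
    with least[OF that] p2 P show False by (simp add: prime_dvd_mult_iff)
  qed
  have "s (Suc j * d) \<noteq> s (j * d) \<and>
         multiplicity (int p) (s (Suc j * d) - s (j * d)) = Suc j * e"
  proof (induction j)
    case 0
    then show ?case using assms by (simp add: e_def)
  next
    case (Suc j)
    define R where "R = (\<Prod>l\<in>{..<d} - {0}. s (Suc j * d + l) + s (j * d + l))"
    have "s (Suc (Suc j) * d) - s (Suc j * d) = s (Suc j * d + d) - s (j * d + d)"
      by (simp add: algebra_simps)
    also have "\<dots> = (s (Suc j * d) - s (j * d)) * ((s (Suc j * d) + s (j * d)) * R)"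
      unfolding difference_shift R_def using \<open>0 < d\<close>
      by (subst prod.remove[of _ 0]) auto
    finally have eq: "s (Suc (Suc j) * d) - s (Suc j * d) =
        (s (Suc j * d) - s (j * d)) * ((s (Suc j * d) + s (j * d)) * R)" .
    have "\<not> int p dvd R"
      unfolding R_def using unit P by (simp add: prime_dvd_prod_iff)
    then have R: "R \<noteq> 0" "multiplicity (int p) R = 0"
      by (auto intro: not_dvd_imp_multiplicity_0)
    have "s (Suc (Suc j) * d) - s (Suc j * d) \<noteq> 0"
      unfolding eq using R Suc sum[of j] by simp
    moreover have "multiplicity (int p) (s (Suc (Suc j) * d) - s (Suc j * d)) = Suc j * e + e"
      unfolding eq using R Suc sum[of j] P
      by (simp add: prime_elem_multiplicity_mult_distrib)
    ultimately show ?case by simp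
  qed
  then show ?thesis unfolding e_def .
qed


text \<open>
  The hypothesis on \<open>K\<close> is what remains, in the integers, of the finiteness of the critical orbit. It
  leaves a gap in the possible valuations of \<open>s i - s 0\<close>: none lies in \<open>{K..<2 * K}\<close>. But valuations
  that start below \<open>K\<close> and increase by one at a time cannot jump over this gap.
\<close>

lemma stable_near_return:
  assumes "prime p" "odd p" "(int p)\<^sup>2 dvd s d - s 0" "[multiplier d = 1] (mod int p)"
    and stable: "\<And>i. int p ^ K dvd s i - s 0 \<Longrightarrow> int p ^ (2 * K) dvd s i - s 0"
  shows "int p ^ K dvd s d - s 0"
proof (rule ccontr)
  assume not: "\<not> int p ^ K dvd s d - s 0"
  define v where "v = multiplicity (int p) (s d - s 0)"
  have nu: "\<not> is_unit (int p)" using prime_gt_1_nat[OF \<open>prime p\<close>] by simp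
  have ne: "s d \<noteq> s 0" using not by auto
  then have "v < K"
    using not nu by (simp add: v_def power_dvd_iff_le_multiplicity)
  have j: "s (p ^ K * d) \<noteq> s 0" "multiplicity (int p) (s (p ^ K * d) - s 0) = v + K"
    using multiplicity_return[OF assms(1-3) ne assms(4)] by (simp_all add: v_def)
  then have "int p ^ K dvd s (p ^ K * d) - s 0" by (intro multiplicity_dvd') simp
  from stable[OF this] have "2 * K \<le> v + K"
    using j nu by (simp add: power_dvd_iff_le_multiplicity)
  with \<open>v < K\<close> show False by simp
qed

text \<open>
  Here \<open>r\<close> is the least positive \<open>t\<close> for which \<open>p\<close> divides \<open>1 + M + \<dots> + M ^ (t - 1)\<close>, where \<open>M\<close> is
  the multiplier. One such \<open>t\<close> is \<open>p\<close> if \<open>M\<close> is \<open>1\<close> modulo \<open>p\<close>, and \<open>p - 1\<close> otherwise, by Fermat's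
  little theorem.
\<close>

lemma stable_return_structure:
  assumes "prime p" "odd p" "1 \<le> k"
    and k: "int p ^ k dvd s d - s 0" "\<not> int p ^ Suc k dvd s d - s 0"
    and unit: "\<And>i. \<not> int p dvd s i"
    and stable: "\<And>i. int p ^ K dvd s i - s 0 \<Longrightarrow> int p ^ (2 * K) dvd s i - s 0"
  obtains r where "0 < r" "int p ^ K dvd s (r * d) - s 0"
    "\<And>t. 0 < t \<Longrightarrow> t < r \<Longrightarrow> \<not> int p ^ Suc k dvd s (t * d) - s 0"
proof -
  define M where "M = multiplier d"
  have P: "prime (int p)" using \<open>prime p\<close> by simp
  have p0: "0 < int p" using prime_gt_0_nat[OF \<open>prime p\<close>] by simp
  have p2: "\<not> int p dvd 2"
    by (rule odd_prime_not_dvd_two) fact+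
  have pd: "int p dvd s d - s 0"
    using \<open>1 \<le> k\<close> by (intro dvd_trans[OF dvd_power k(1)]) simp
  have iff: "int p ^ Suc k dvd s (t * d) - s 0 \<longleftrightarrow> int p dvd (\<Sum>j<t. M ^ j)" for t
  proof -
    obtain u where u: "s d - s 0 = int p ^ k * u" using k(1) by (elim dvdE)
    have "\<not> int p dvd u" using k(2) p0 by (simp add: u mult.commute)
    obtain T where T: "s (t * d) - s 0 = (s d - s 0) * T" "[T = (\<Sum>j<t. M ^ j)] (mod int p)"
      using return_difference[OF pd] unfolding M_def by blast
    have "int p ^ Suc k dvd s (t * d) - s 0 \<longleftrightarrow> int p ^ k * int p dvd int p ^ k * (u * T)"
      unfolding T(1) u by (simp add: ac_simps)
    also have "\<dots> \<longleftrightarrow> int p dvd T"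
      using p0 P \<open>\<not> int p dvd u\<close> by (simp add: prime_dvd_mult_iff)
    also have "\<dots> \<longleftrightarrow> int p dvd (\<Sum>j<t. M ^ j)" using T(2) by (rule cong_dvd_iff)
    finally show ?thesis .
  qed
  have "\<not> int p dvd M"
    unfolding M_def multiplier_def using unit P p2
    by (simp add: prime_dvd_prod_iff prime_dvd_mult_iff)
  have ex: "\<exists>t. 0 < t \<and> int p dvd (\<Sum>j<t. M ^ j)"
  proof (cases "[M = 1] (mod int p)")
    case True
    have "[(\<Sum>j<p. M ^ j) = (\<Sum>j<p. 1)] (mod int p)"
      using cong_pow[OF True] by (intro cong_sum) simp
    from cong_dvd_iff[OF this] have "int p dvd (\<Sum>j<p. M ^ j)" by simp
    with p0 show ?thesis by auto
  next
    case False
    have "[M ^ (p - 1) = 1] (mod int p)"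
      using \<open>prime p\<close> \<open>\<not> int p dvd M\<close> by (rule fermat_little_int)
    then have "int p dvd (M - 1) * (\<Sum>j<p - 1. M ^ j)"
      by (simp add: cong_iff_dvd_diff power_diff_1_eq)
    then have "int p dvd (\<Sum>j<p - 1. M ^ j)"
      using False P by (simp add: prime_dvd_mult_iff cong_iff_dvd_diff)
    then show ?thesis using prime_gt_1_nat[OF \<open>prime p\<close>] by (intro exI[of _ "p - 1"]) simp
  qed
  define r where "r = (LEAST t. 0 < t \<and> int p dvd (\<Sum>j<t. M ^ j))"
  have r: "0 < r" "int p dvd (\<Sum>j<r. M ^ j)"
    using LeastI_ex[OF ex] unfolding r_def by simp_all
  have least: "\<not> int p dvd (\<Sum>j<t. M ^ j)" if "0 < t" "t < r" for t
    using not_less_Least[of t "\<lambda>t. 0 < t \<and> int p dvd (\<Sum>j<t. M ^ j)"] that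
    unfolding r_def by blast
  have "int p ^ K dvd s (r * d) - s 0"
  proof (rule stable_near_return[OF \<open>prime p\<close> \<open>odd p\<close>])
    have "int p ^ 2 dvd int p ^ Suc k" using \<open>1 \<le> k\<close> by (intro le_imp_power_dvd) simp
    moreover have "int p ^ Suc k dvd s (r * d) - s 0" unfolding iff by (rule r)
    ultimately show "(int p)\<^sup>2 dvd s (r * d) - s 0" by (rule dvd_trans)
    have "int p dvd M ^ r - 1" using r(2) by (simp add: power_diff_1_eq)
    then have "[M ^ r = 1] (mod int p)" by (simp add: cong_iff_dvd_diff)
    with multiplier_power_cong[OF pd, of r]
    show "[multiplier (r * d) = 1] (mod int p)" unfolding M_def by (rule cong_trans)
  qed (rule stable)
  with r(1) least show thesis using that iff by blast
qed

end


section \<open>The critical orbit in the p-adic integers\<close>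

text \<open>
  Used for the critical orbit itself and for its reduction modulo \<open>p\<close>.
\<close>

lemma return_time_dvd:
  assumes shift: "\<And>i j. f i = f j \<Longrightarrow> f (Suc i) = f (Suc j)"
    and "0 < d" "f (m + d) = f m" and least: "\<And>i. 0 < i \<Longrightarrow> i < d \<Longrightarrow> f (m + i) \<noteq> f m"
    and b: "f (m + b) = f m"
  shows "d dvd b"
proof -
  have shifts: "f (i + t) = f (j + t)" if "f i = f j" for i j t
  proof (induction t)
    case (Suc t)
    from shift[OF this] show ?case by simp
  qed (simp add: that)
  have "f (m + t * d) = f m" for t
  proof (induction t)
    case (Suc t)
    have "f (m + Suc t * d) = f (m + t * d + d)" by (simp add: ac_simps)
    also have "\<dots> = f (m + d)" by (rule shifts[OF Suc])
    finally show ?case unfolding assms(3) .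
  qed simp
  from shifts[OF this[of "b div d"], of "b mod d"] have "f (m + b) = f (m + b mod d)"
    by (simp add: add.assoc)
  then have "f (m + b mod d) = f m" unfolding b by (rule sym)
  with least[of "b mod d"] \<open>0 < d\<close> have "b mod d = 0" by (cases "b mod d = 0") simp_all
  then show ?thesis by (rule mod_0_imp_dvd)
qed

locale finite_critical_orbit =
  fixes p :: nat and c :: "nat \<Rightarrow> int"
  assumes prime: "prime p" and p3: "3 \<le> p" and c: "c \<in> carrier (Zp p)"
    and finite: "finite (critical_orbit p c)"
begin

definition x :: "nat \<Rightarrow> nat \<Rightarrow> int" where
  "x i = (quad_map p c ^^ i) \<zero>\<^bsub>Zp p\<^esub>"

lemma p2: "2 \<le> p" and p0: "0 < p"
  using p3 by simp_all

lemma odd_p: "odd p"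
  using prime p3 by (intro prime_odd_nat) simp_all

lemma critical_orbit_eq: "critical_orbit p c = range x"
  unfolding critical_orbit_def x_def by auto

lemma x_closed: "x i \<in> carrier (Zp p)"
  by (rule critical_orbit_closed[OF p0 c]) (simp add: critical_orbit_eq)

lemma x_Suc: "x (Suc i) = quad_map p c (x i)"
  by (simp add: x_def)

lemma x_shift: "x i = x j \<Longrightarrow> x (i + t) = x (j + t)"
  by (induction t) (simp_all add: x_Suc)

lemma level_shift: "x i k = x j k \<Longrightarrow> x (i + t) k = x (j + t) k"
  by (induction t) (simp_all add: x_Suc quad_map_eq[OF x_closed p0])

lemma level_mono: "x i k = x j k \<Longrightarrow> l \<le> k \<Longrightarrow> x i l = x j l"
  using Zp_mod_le[OF x_closed, of l k i] Zp_mod_le[OF x_closed, of l k j] by simp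

text \<open>
  Any integer congruent to \<open>c\<close> modulo \<open>p ^ K\<close> can serve as \<open>C\<close>; the canonical residue \<open>c K\<close> is at hand.
\<close>

lemma integer_lift:
  "\<exists>s C. quadratic_sequence s C \<and> s 0 = 0 \<and>
    (\<forall>i j k. k \<le> K \<longrightarrow> x i k = x j k \<longleftrightarrow> int p ^ k dvd s i - s j)"
proof -
  define s where "s i = ((\<lambda>z. z\<^sup>2 + c K) ^^ i) 0" for i
  have rec: "s (Suc i) = (s i)\<^sup>2 + c K" for i by (simp add: s_def)
  have "quadratic_sequence s (c K)" by unfold_locales (rule rec)
  moreover have "s 0 = 0" by (simp add: s_def)
  moreover have "x i k = x j k \<longleftrightarrow> int p ^ k dvd s i - s j" if "k \<le> K" for i j k
  proof -
  have *: "x i k = s i mod int p ^ k" for i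
  proof (induction i)
    case 0
    show ?case by (simp add: x_def s_def Zp_simps)
  next
    case (Suc i)
    have "c k = c K mod int p ^ k" using Zp_mod_le[OF c that] by simp
    then have "x (Suc i) k = ((s i mod int p ^ k)\<^sup>2 + c K mod int p ^ k) mod int p ^ k"
      by (simp add: x_Suc quad_map_eq[OF x_closed p0] Suc)
    also have "\<dots> = s (Suc i) mod int p ^ k"
      unfolding rec by (rule mod_add_cong) (simp_all add: power_mod)
    finally show ?case .
  qed
    show ?thesis by (simp add: * mod_eq_dvd_iff)
  qed
  ultimately show ?thesis by blast
qed

lemma separating_level: "\<exists>K. \<forall>i j. x i K = x j K \<longrightarrow> x i = x j"
proof -
  let ?O = "critical_orbit p c"
  have "eventually (\<lambda>k. x i \<noteq> x j \<longrightarrow> x i k \<noteq> x j k) sequentially" for i j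
  proof (cases "x i = x j")
    case False
    then obtain l where "x i l \<noteq> x j l" by (meson ext)
    then have "x i k \<noteq> x j k" if "l \<le> k" for k using level_mono that by blast
    then show ?thesis unfolding eventually_sequentially by blast
  qed simp
  then have "eventually (\<lambda>k. \<forall>u\<in>?O. \<forall>v\<in>?O. u \<noteq> v \<longrightarrow> u k \<noteq> v k) sequentially"
    by (intro eventually_ball_finite finite ballI) (auto simp: critical_orbit_eq)
  then obtain K where "\<forall>u\<in>?O. \<forall>v\<in>?O. u \<noteq> v \<longrightarrow> u K \<noteq> v K"
    unfolding eventually_sequentially by blast
  then show ?thesis unfolding critical_orbit_eq by blast
qed

text \<open>
  By \<open>multiplicity_critical_return\<close>, if \<open>x d\<close> had a finite valuation \<open>e\<close>, then the points with
  indices \<open>K * d\<close> and \<open>Suc K * d\<close> would agree modulo \<open>p ^ K\<close>, hence be equal, although their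
  difference has valuation \<open>Suc K * e\<close>. To see the latter, integers modulo \<open>p ^ (Suc K * K)\<close> suffice,
  because \<open>e < K\<close>.
\<close>

lemma critical_return:
  assumes "0 < d" "x d 1 = x 0 1" and least: "\<And>i. 0 < i \<Longrightarrow> i < d \<Longrightarrow> x i 1 \<noteq> x 0 1"
  shows "x d = x 0"
proof (rule ccontr)
  assume ne: "x d \<noteq> x 0"
  obtain K where K: "\<And>i j. x i K = x j K \<Longrightarrow> x i = x j" using separating_level by blast
  have neK: "x d K \<noteq> x 0 K" using ne K by blast
  then have "K \<noteq> 0"
    using Zp_mod[OF x_closed, of d 0] Zp_mod[OF x_closed, of 0 0] by (cases "K = 0") simp_all
  obtain s C where s: "quadratic_sequence s C" "s 0 = 0"
    and lift: "\<And>i j k. k \<le> Suc K * K \<Longrightarrow> x i k = x j k \<longleftrightarrow> int p ^ k dvd s i - s j"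
    using integer_lift[of "Suc K * K"] by blast
  interpret quadratic_sequence s C by (rule s(1))
  have nu: "\<not> is_unit (int p)" using p2 by simp
  have 1: "x i 1 = x 0 1 \<longleftrightarrow> int p dvd s i" for i
    using lift[of 1 i 0] \<open>K \<noteq> 0\<close> s(2) by simp
  define e where "e = multiplicity (int p) (s d)"
  have "\<not> int p ^ K dvd s d" using lift[of K d 0] neK s(2) by simp
  moreover from this have "s d \<noteq> 0" by auto
  ultimately have "e < K" using nu by (simp add: e_def power_dvd_iff_le_multiplicity)
  have "int p dvd s d" using assms(2) 1 by simp
  then have "1 \<le> e" using \<open>s d \<noteq> 0\<close> nu by (simp add: e_def multiplicity_geI)
  define D where "D = s (Suc K * d) - s (K * d)"
  have "D \<noteq> 0" "multiplicity (int p) D = Suc K * e"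
    using multiplicity_critical_return[OF prime odd_p s(2) \<open>0 < d\<close> \<open>s d \<noteq> 0\<close> \<open>int p dvd s d\<close>, of K]
      least 1 unfolding e_def D_def by simp_all
  then have dvd: "int p ^ k dvd D \<longleftrightarrow> k \<le> Suc K * e" for k
    using nu by (simp add: power_dvd_iff_le_multiplicity)
  have "K \<le> Suc K * e" using \<open>1 \<le> e\<close> by (cases e) simp_all
  then have "int p ^ K dvd D" by (simp only: dvd)
  then have "x (Suc K * d) K = x (K * d) K" using lift[of K] unfolding D_def by simp
  then have "x (Suc K * d) = x (K * d)" by (rule K)
  then have "int p ^ (Suc K * K) dvd D"
    using lift[OF order_refl, of "Suc K * d" "K * d"] unfolding D_def by (simp only: simp_thms)
  then have "Suc K * K \<le> Suc K * e" using dvd by blast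
  with \<open>e < K\<close> show False by (simp only: Suc_mult_le_cancel1)
qed

lemma periodic_if_periodic_mod:
  assumes "0 < d" "x d 1 = x 0 1"
  obtains e where "0 < e" "e \<le> d" "x e = x 0"
proof -
  define e where "e = (LEAST i. 0 < i \<and> x i 1 = x 0 1)"
  have e: "0 < e \<and> x e 1 = x 0 1"
    unfolding e_def by (rule LeastI[of "\<lambda>i. 0 < i \<and> x i 1 = x 0 1" d]) (intro conjI assms)
  have "e \<le> d"
    unfolding e_def by (rule Least_le[of "\<lambda>i. 0 < i \<and> x i 1 = x 0 1"]) (intro conjI assms)
  have "x i 1 \<noteq> x 0 1" if "0 < i" "i < e" for i
    using not_less_Least[of i "\<lambda>i. 0 < i \<and> x i 1 = x 0 1"] that unfolding e_def by blast
  with e have "x e = x 0" by (intro critical_return) blast+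
  with e \<open>e \<le> d\<close> show thesis by (intro that[of e]) blast+
qed

lemma has_exact_period_iff:
  "has_exact_period (quad_map p c) \<zero>\<^bsub>Zp p\<^esub> n \<longleftrightarrow>
     0 < n \<and> x n = x 0 \<and> (\<forall>j. 0 < j \<and> j < n \<longrightarrow> x j \<noteq> x 0)"
  unfolding has_exact_period_def x_def One_nat_def Suc_le_eq funpow_0 by (rule refl)

text \<open>
  Moving both points forward by \<open>n - j\<close> steps turns \<open>x j\<close> into \<open>0\<close>.
\<close>

lemma periodic_distinct_mod:
  assumes n: "0 < n" "x n = x 0" and least: "\<And>j. 0 < j \<Longrightarrow> j < n \<Longrightarrow> x j \<noteq> x 0"
    and "i < j" "j < n"
  shows "x i 1 \<noteq> x j 1"
proof
  assume "x i 1 = x j 1"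
  then have "x (i + (n - j)) 1 = x (j + (n - j)) 1" by (rule level_shift)
  then have "x (i + (n - j)) 1 = x 0 1" using n(2) \<open>j < n\<close> by simp
  then obtain e where "0 < e" "e \<le> i + (n - j)" "x e = x 0"
    using periodic_if_periodic_mod[of "i + (n - j)"] \<open>j < n\<close> by auto
  with least[of e] \<open>i < j\<close> \<open>j < n\<close> show False by fastforce
qed

lemma periodic_x_mod:
  assumes "x n = x 0"
  shows "x (i mod n) = x i"
proof -
  have "x (t * n) = x 0" for t
  proof (induction t)
    case (Suc t)
    from x_shift[OF this, of n] show ?case using assms by (simp add: add.commute)
  qed simp
  from x_shift[OF this, of "i div n" "i mod n"] show ?thesis by simp
qed


end

section \<open>Strictly preperiodic critical orbits\<close>

locale preperiodic_critical_orbit = finite_critical_orbit +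
  fixes m n :: nat
  assumes type: "has_orbit_type (quad_map p c) \<zero>\<^bsub>Zp p\<^esub> m n" and m0: "0 < m"
begin

lemma n0: "0 < n" and x_mn: "x (m + n) = x m"
  using type by (simp_all add: has_orbit_type_def x_def)

lemma type_least: "0 < b \<Longrightarrow> x (i + b) = x i \<Longrightarrow> m \<le> i \<and> n \<le> b"
  using type unfolding has_orbit_type_def x_def by (simp add: Suc_le_eq)

lemma unit: "0 < i \<Longrightarrow> x i 1 \<noteq> x 0 1"
proof
  assume "0 < i" "x i 1 = x 0 1"
  then obtain e where "0 < e" "x e = x 0" by (rule periodic_if_periodic_mod)
  with type_least[of e 0] m0 show False by simp
qed

lemma x_add_n: "m \<le> i \<Longrightarrow> x (i + t * n) = x i"
proof (induction t)
  case (Suc t)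
  have "x (m + n + (i - m)) = x (m + (i - m))" using x_mn by (rule x_shift)
  then have "x (i + n) = x i" using Suc by (simp add: ac_simps)
  from x_shift[OF Suc.IH[OF Suc.prems], of n] this show ?case by (simp add: ac_simps)
qed simp

text \<open>
  Going round the cycle, a coincidence at any cyclic point is transported to the base point \<open>x m\<close>.
\<close>

lemma rotate:
  assumes "m \<le> i" "x (i + b) k = x i k"
  shows "x (m + b) k = x m k"
proof -
  have "i \<le> m + i * n" using n0 by (cases n) simp_all
  then have t: "i + (m + i * n - i) = m + i * n" by (rule le_add_diff_inverse)
  have "x (m + b) k = x (m + b + i * n) k" by (simp add: x_add_n)
  also have "m + b + i * n = i + b + (m + i * n - i)" using t by simp
  also have "x \<dots> k = x (i + (m + i * n - i)) k" using assms(2) by (rule level_shift)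
  also have "\<dots> = x m k" unfolding t by (simp add: x_add_n)
  finally show ?thesis .
qed

lemma unrotate:
  assumes "m \<le> i" "x (m + b) k = x m k"
  shows "x (i + b) k = x i k"
  using level_shift[OF assms(2), of "i - m"] assms(1) by (simp add: ac_simps)

text \<open>
  Moving forward, one may take \<open>i = m - 1\<close>. This point and \<open>x (m + n - 1)\<close> are distinct with the same
  square, so they are opposite to each other. If \<open>x (m - 1)\<close> lay in the class of a cyclic point, it
  would lie in the class of \<open>x (m + n - 1)\<close>, the only cyclic class that is mapped to the class of \<open>x m\<close>.
  A class that is its own opposite is the class of \<open>0\<close>, and the cycle avoids that one.
\<close>

lemma tail_not_cyclic_mod:
  assumes "i < m" "m \<le> j"
  shows "x i 1 \<noteq> x j 1"
proof
  assume "x i 1 = x j 1"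
  \<comment> \<open>Push the coincidence forward until the tail point is the last one, with index \<open>m - 1\<close>.\<close>
  define a where "a = m - 1"
  define b where "b = j + (a - i)"
  have a: "Suc a = m" and b: "m \<le> b" and i: "i + (a - i) = a" using assms by (simp_all add: a_def b_def)
  have ab: "x a 1 = x b 1" using level_shift[OF \<open>x i 1 = x j 1\<close>, of "a - i"] unfolding i b_def .
  have "x (m + (Suc b - m)) 1 = x m 1" using level_shift[OF ab, of 1] a b by simp
  from unrotate[OF _ this, of "a + n"] n0 a have "x (a + n + (Suc b - m)) 1 = x (a + n) 1"
    by simp
  moreover have "a + n + (Suc b - m) = b + n" using a b by arith
  ultimately have "x (a + n) 1 = x (b + n) 1" by metis
  also have "\<dots> = x b 1" using x_add_n[OF b, of 1] by simp
  finally have an: "x (a + n) 1 = x b 1" .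
  obtain K where K: "\<And>i j. x i K = x j K \<Longrightarrow> x i = x j" using separating_level by blast
  obtain s C where s: "quadratic_sequence s C" "s 0 = 0"
    and lift: "\<And>i j k. k \<le> Suc K \<Longrightarrow> x i k = x j k \<longleftrightarrow> int p ^ k dvd s i - s j"
    using integer_lift[of "Suc K"] by blast
  interpret quadratic_sequence s C by (rule s(1))
  have P: "prime (int p)" using prime by simp
  have "x (a + n) \<noteq> x a" using type_least[of n a] n0 a by auto
  then have "x (a + n) K \<noteq> x a K" using K by blast
  then have not: "\<not> int p ^ K dvd s (a + n) - s a" using lift[of K] by simp
  have "int p ^ K dvd s (Suc a + n) - s (Suc a)"
    using lift[of K "Suc a + n" "Suc a"] x_mn unfolding a by simp
  also have "s (Suc a + n) - s (Suc a) = (s (a + n) - s a) * (s (a + n) + s a)"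
    by (simp add: step power2_eq_square algebra_simps)
  finally have prod: "int p ^ K dvd (s (a + n) - s a) * (s (a + n) + s a)" .
  have sum: "int p dvd s (a + n) + s a"
  proof (rule ccontr)
    assume "\<not> int p dvd s (a + n) + s a"
    then have "coprime (int p ^ K) (s (a + n) + s a)"
      using prime_imp_coprime[OF P] by simp
    with prod not show False by (simp add: coprime_dvd_mult_left_iff)
  qed
  have "int p dvd (s (a + n) - s b) + (s a - s b)"
    using lift[of 1] an ab by (intro dvd_add) simp_all
  from dvd_diff[OF sum this] have "int p dvd 2 * s b" by simp
  then have "int p dvd s b"
    using odd_prime_not_dvd_two[OF prime odd_p] P by (simp add: prime_dvd_mult_iff)
  then have "x b 1 = x 0 1" using lift[of 1 b 0] s(2) by simp
  with unit[of b] b m0 show False by simp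
qed

lemma tail_isolated_mod:
  assumes "i < m" "x i 1 = x j 1"
  shows "i = j"
proof -
  have less: "x i 1 \<noteq> x j 1" if "i < j" "i < m" for i j
  proof (cases "m \<le> j")
    case True
    then show ?thesis using tail_not_cyclic_mod that by blast
  next
    case False
    have "x (i + (m - j)) 1 \<noteq> x (j + (m - j)) 1"
      using tail_not_cyclic_mod[of "i + (m - j)" m] that False by simp
    then show ?thesis using level_shift by blast
  qed
  from less[of i j] less[of j i] assms show ?thesis by (metis linorder_neqE_nat less_trans)
qed

lemma cyclic_eqI:
  assumes "m \<le> i" "m \<le> j" "x i k = x j k"
    and return: "\<And>b. x (m + b) k = x m k \<Longrightarrow> x (m + b) = x m"
  shows "x i = x j"
proof -
  have *: "x j = x i" if "m \<le> i" "i \<le> j" "x i k = x j k" for i j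
  proof -
    have j: "i + (j - i) = j" using that by simp
    have "x (m + (j - i)) k = x m k" by (rule rotate[OF \<open>m \<le> i\<close>]) (simp add: j that(3))
    then have "x (m + (j - i)) = x m" by (rule return)
    from x_shift[OF this, of "i - m"] that show ?thesis by (simp add: ac_simps)
  qed
  show ?thesis using *[of i j] *[of j i] assms(1-3) by (metis nat_le_linear)
qed

text \<open>The period of the cycle modulo \<open>p\<close>.\<close>

definition d :: nat where
  "d = (LEAST i. 0 < i \<and> x (m + i) 1 = x m 1)"

lemma d0: "0 < d" and x_md: "x (m + d) 1 = x m 1" and d_le: "d \<le> n"
proof -
  have n: "0 < n \<and> x (m + n) 1 = x m 1" using n0 x_mn by simp
  show "d \<le> n" unfolding d_def using n by (rule Least_le)
  from LeastI[of "\<lambda>i. 0 < i \<and> x (m + i) 1 = x m 1", OF n]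
  show "0 < d" "x (m + d) 1 = x m 1" unfolding d_def by blast+
qed

lemma d_dvd:
  assumes "x (m + b) 1 = x m 1"
  shows "d dvd b"
proof (rule return_time_dvd[of "\<lambda>i. x i 1", OF _ d0 x_md _ assms])
  show "x (Suc i) 1 = x (Suc j) 1" if "x i 1 = x j 1" for i j
    using level_shift[OF that, of 1] by simp
  show "x (m + i) 1 \<noteq> x m 1" if "0 < i" "i < d" for i
    using not_less_Least[of i "\<lambda>i. 0 < i \<and> x (m + i) 1 = x m 1"] that unfolding d_def by blast
qed

lemma n_dvd:
  assumes "x (m + b) = x m"
  shows "n dvd b"
proof (rule return_time_dvd[of x, OF _ n0 x_mn _ assms])
  show "x (Suc i) = x (Suc j)" if "x i = x j" for i j
    using that by (simp add: x_Suc)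
  show "x (m + i) \<noteq> x m" if "0 < i" "i < n" for i
    using type_least[of i m] that by auto
qed

lemma unbranched:
  assumes "d = n" "x i 1 = x j 1"
  shows "x i = x j"
proof (cases "i < m \<or> j < m")
  case True
  then show ?thesis using tail_isolated_mod assms(2) by metis
next
  case False
  show ?thesis
  proof (rule cyclic_eqI[of _ _ 1])
    fix b assume "x (m + b) 1 = x m 1"
    then obtain t where "b = n * t" using d_dvd assms(1) by (auto elim: dvdE)
    then show "x (m + b) = x m" using x_add_n[of m t] by (simp add: mult.commute)
  qed (use False assms(2) in auto)
qed

text \<open>
  This is \<open>stable_return_structure\<close> for the integer lift of the orbit started at \<open>x m\<close>. It yields a
  closed orbit of \<open>r * d\<close> steps whose intermediate returns are separated modulo \<open>p ^ (k + 1)\<close>; so the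
  exact period \<open>n\<close>, a multiple of \<open>d\<close>, can only be \<open>r * d\<close>.
\<close>

lemma branching_level:
  assumes "d \<noteq> n"
  obtains k r where "1 \<le> k" "2 \<le> r" "n = r * d" "x (m + d) k = x m k"
    "\<And>t. 0 < t \<Longrightarrow> t < r \<Longrightarrow> x (m + t * d) (Suc k) \<noteq> x m (Suc k)"
proof -
  have "d < n" using d_le assms by simp
  then have ne: "x (m + d) \<noteq> x m" using type_least[of d m] d0 by auto
  obtain K where K: "\<And>i j. x i K = x j K \<Longrightarrow> x i = x j" using separating_level by blast
  have "x (m + d) K \<noteq> x m K" using ne K by blast
  then have bound: "k < K" if "x (m + d) k = x m k" for k
    using level_mono[OF that, of K] by (meson not_le)
  define k where "k = (GREATEST k. x (m + d) k = x m k)"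
  have k: "x (m + d) k = x m k" unfolding k_def
    by (rule GreatestI_nat[of "\<lambda>k. x (m + d) k = x m k", OF x_md]) (use bound in \<open>blast intro: less_imp_le\<close>)
  have le_k: "l \<le> k" if "x (m + d) l = x m l" for l unfolding k_def
    by (rule Greatest_le_nat[of "\<lambda>k. x (m + d) k = x m k", OF that]) (use bound in \<open>blast intro: less_imp_le\<close>)
  have "1 \<le> k" using le_k[OF x_md] .
  have "k < K" using bound[OF k] .
  obtain s C where s: "quadratic_sequence s C" "s 0 = 0"
    and lift: "\<And>i j k. k \<le> 2 * K \<Longrightarrow> x i k = x j k \<longleftrightarrow> int p ^ k dvd s i - s j"
    using integer_lift[of "2 * K"] by blast
  define s' where "s' i = s (m + i)" for i
  interpret quadratic_sequence s' C
    using quadratic_sequence.step[OF s(1)] unfolding s'_def by unfold_locales simp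
  have lift': "x (m + i) k = x m k \<longleftrightarrow> int p ^ k dvd s' i - s' 0" if "k \<le> 2 * K" for i k
    using lift[OF that] by (simp add: s'_def)
  obtain r where r: "0 < r" "int p ^ K dvd s' (r * d) - s' 0"
    "\<And>t. 0 < t \<Longrightarrow> t < r \<Longrightarrow> \<not> int p ^ Suc k dvd s' (t * d) - s' 0"
  proof (rule stable_return_structure[OF prime odd_p \<open>1 \<le> k\<close>, of d K])
    show "int p ^ k dvd s' d - s' 0" using lift'[of k d] k \<open>k < K\<close> by simp
    show "\<not> int p ^ Suc k dvd s' d - s' 0"
      using lift'[of "Suc k" d] le_k[of "Suc k"] \<open>k < K\<close> by auto
    show "\<not> int p dvd s' i" for i
      using lift[of 1 "m + i" 0] unit[of "m + i"] m0 \<open>k < K\<close> s(2) by (simp add: s'_def)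
    show "int p ^ (2 * K) dvd s' i - s' 0" if "int p ^ K dvd s' i - s' 0" for i
    proof -
      have "x (m + i) = x m" using that lift'[of K i] by (intro K) simp
      then show ?thesis using lift'[of "2 * K" i] by simp
    qed
  qed blast
  have sep: "x (m + t * d) (Suc k) \<noteq> x m (Suc k)" if "0 < t" "t < r" for t
    using lift'[of "Suc k" "t * d"] r(3)[OF that] \<open>k < K\<close> by simp
  have "x (m + r * d) = x m" using r(2) lift'[of K "r * d"] by (intro K) simp
  then have "n dvd r * d" by (rule n_dvd)
  have "d dvd n" using d_dvd[of n] x_mn by simp
  define t where "t = n div d"
  have t: "n = t * d" unfolding t_def using \<open>d dvd n\<close> by (rule dvd_div_mult_self[symmetric])
  have "t dvd r" using \<open>n dvd r * d\<close> d0 unfolding t by simp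
  then have "t \<le> r" using r(1) by (rule dvd_imp_le)
  moreover have "0 < t" using t n0 by (cases t) simp_all
  moreover have "\<not> t < r" using sep[of t] x_mn \<open>0 < t\<close> unfolding t by auto
  ultimately have "n = r * d" using t by simp
  moreover have "2 \<le> r" using \<open>n = r * d\<close> \<open>d < n\<close> r(1) by (cases "r = 1") auto
  ultimately show thesis using that[OF \<open>1 \<le> k\<close> _ _ k sep] by blast
qed

end

section \<open>From orbit points to trees\<close>

context finite_critical_orbit
begin

definition disk :: "nat \<Rightarrow> nat \<Rightarrow> (nat \<Rightarrow> int) set" where
  "disk i k = closed_disk p (x i) (1 / real p ^ k)"

lemma disk_eq: "disk i k = {y \<in> carrier (Zp p). y k = x i k}"
  unfolding disk_def by (rule closed_disk_eq[OF p2 x_closed])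

lemma x_in_disk: "x j \<in> disk i k \<longleftrightarrow> x j k = x i k"
  by (simp add: disk_eq x_closed)

lemma disk_eq_iff: "disk i k = disk j k \<longleftrightarrow> x i k = x j k"
  using x_in_disk by (auto simp: disk_eq)

lemma disk_level: "disk i k \<in> level p l \<longleftrightarrow> k = l"
proof -
  have "disk i k \<in> level p k" unfolding disk_def level_def using x_closed by blast
  then show ?thesis using levels_disjoint[OF p2] by blast
qed

lemma disk_subset_iff:
  assumes "k \<le> l"
  shows "disk i l \<subseteq> disk j k \<longleftrightarrow> x i k = x j k"
proof
  assume "disk i l \<subseteq> disk j k"
  then show "x i k = x j k" using x_in_disk by blast
next
  assume eq: "x i k = x j k"
  have "y k = x j k" if "y \<in> carrier (Zp p)" "y l = x i l" for y
    using Zp_mod_le[OF that(1) assms] Zp_mod_le[OF x_closed assms, of i] that(2) eq by simp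
  then show "disk i l \<subseteq> disk j k" by (auto simp: disk_eq)
qed

lemma critical_orbit_tree_verts: "pverts (critical_orbit_tree p c) = {disk i k | i k. True}"
  by (auto simp: critical_orbit_tree_def induced_def critical_orbit_eq path_to_def disk_def)

lemma critical_orbit_tree_level:
  "pverts (critical_orbit_tree p c) \<inter> level p k = range (\<lambda>i. disk i k)"
  unfolding critical_orbit_tree_verts by (auto simp: disk_level)

lemma vertex_map_disk: "vertex_map p c (disk i k) = disk (Suc i) k"
  unfolding disk_def x_Suc by (rule vertex_map_closed_disk[OF p2 c x_closed])

lemma vertex_map_disk_funpow: "(vertex_map p c ^^ b) (disk i k) = disk (i + b) k"
  by (induction b) (simp_all add: vertex_map_disk)

lemma periodic_vertex_iff:
  "periodic_vertex p c (disk i k) \<longleftrightarrow> (\<exists>b\<ge>1. x (i + b) k = x i k)"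
  by (simp add: periodic_vertex_def vertex_map_disk_funpow disk_eq_iff)

lemma descendants_disk:
  assumes "k \<le> l"
  shows "descendants p c l (disk i k) = {disk j l | j. x j k = x i k}"
  unfolding descendants_def critical_orbit_tree_verts
  using disk_subset_iff[OF assms] by (auto simp: disk_level)

lemma coincides_modI:
  assumes "\<And>i j. x i 1 = x j 1 \<Longrightarrow> x i = x j"
  shows "coincides_mod p c"
  unfolding coincides_mod_def
proof (intro ballI)
  fix v y z assume v: "v \<in> level p 1" and y: "y \<in> v \<inter> critical_orbit p c"
    and z: "z \<in> v \<inter> critical_orbit p c"
  obtain i j where ij: "y = x i" "z = x j" using y z unfolding critical_orbit_eq by blast
  obtain a where "a \<in> carrier (Zp p)" "v = {y \<in> carrier (Zp p). y 1 = a 1}"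
    using v closed_disk_eq[OF p2, of _ 1] unfolding level_def by auto
  then have "x i 1 = x j 1" using y z unfolding ij by simp
  then show "y = z" unfolding ij by (rule assms)
qed

end

context preperiodic_critical_orbit
begin

lemma coincides_if_no_branching:
  assumes "d = n"
  shows "coincides_mod p c"
  by (rule coincides_modI) (rule unbranched[OF assms])

text \<open>
  The orbit points in the class of a cyclic point \<open>x i\<close> are \<open>x (i + t * d)\<close> with \<open>t < r\<close>. Since the map
  preserves distances along the cycle, the picture at \<open>x m\<close> from \<open>branching_level\<close> is the picture at
  every \<open>x i\<close>, with the same \<open>k\<close> and \<open>r\<close>: they agree modulo \<open>p ^ k\<close> and are distinct modulo
  \<open>p ^ (k + 1)\<close>.
\<close>

lemma one_branching_if_branching:
  assumes "d \<noteq> n"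
  shows "one_branching p c"
proof -
  obtain k r where k: "1 \<le> k" and r: "2 \<le> r" "n = r * d" and xk: "x (m + d) k = x m k"
    and sep: "\<And>t. 0 < t \<Longrightarrow> t < r \<Longrightarrow> x (m + t * d) (Suc k) \<noteq> x m (Suc k)"
    using branching_level[OF assms] by metis
  have near: "x (m + t * d) k = x m k" for t
  proof (induction t)
    case (Suc t)
    from level_shift[OF this, of d] xk show ?case by (simp add: ac_simps)
  qed simp
  have cluster: "x (i + t * d) k = x i k" if "m \<le> i" for i t
    by (rule unrotate[OF that near])
  have cluster_inj: "inj_on (\<lambda>t. x (i + t * d) (Suc k)) {..<r}" if "m \<le> i" for i
  proof (rule linorder_inj_onI)
    fix t u assume "t < u" and u: "u \<in> {..<r}"
    show "x (i + t * d) (Suc k) \<noteq> x (i + u * d) (Suc k)"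
    proof
      assume eq: "x (i + t * d) (Suc k) = x (i + u * d) (Suc k)"
      have "x (m + (u - t) * d) (Suc k) = x m (Suc k)"
      proof (rule rotate[of "i + t * d"])
        have "t * d + (u - t) * d = u * d"
          using \<open>t < u\<close> by (simp flip: add_mult_distrib)
        then show "x (i + t * d + (u - t) * d) (Suc k) = x (i + t * d) (Suc k)"
          using eq by (simp add: add.assoc)
      qed (use that in simp)
      with sep[of "u - t"] \<open>t < u\<close> u show False by (simp add: less_imp_diff_less)
    qed
  qed auto
  have cluster_all: "\<exists>t<r. x j = x (i + t * d)" if "m \<le> i" "x j 1 = x i 1" for i j
  proof -
    have "m \<le> j" using tail_isolated_mod[of j i] that by (metis not_le)
    \<comment> \<open>The point \<open>x j\<close> recurs at index \<open>j + i * n\<close>, which is at least \<open>i\<close> even if \<open>j < i\<close>.\<close>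
    define b where "b = j + i * n - i"
    have b: "i + b = j + i * n" unfolding b_def using n0 by (cases n) simp_all
    have j: "x (i + b) = x j" unfolding b by (rule x_add_n[OF \<open>m \<le> j\<close>])
    have "x (m + b) 1 = x m 1" by (rule rotate[OF \<open>m \<le> i\<close>]) (use that(2) in \<open>simp add: j\<close>)
    then obtain t where t: "b = d * t" using d_dvd by (metis dvdE)
    have "t * d = t mod r * d + t div r * n"
      unfolding r(2) by (metis add_mult_distrib mod_div_mult_eq mult.assoc)
    then have "x (i + b) = x (i + t mod r * d + t div r * n)"
      unfolding t by (simp add: mult.commute add.assoc)
    also have "\<dots> = x (i + t mod r * d)" using \<open>m \<le> i\<close> by (intro x_add_n) simp
    finally show ?thesis using j r(1) by (intro exI[of _ "t mod r"]) simp
  qed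
  have level_1: "if periodic_vertex p c (disk i 1)
         then \<exists>w. descendants p c k (disk i 1) = {w} \<and>
                  card (descendants p c (Suc k) w) = r \<and>
                  (\<forall>u\<in>descendants p c (Suc k) w. \<exists>!y. y \<in> u \<inter> critical_orbit p c)
         else \<exists>!y. y \<in> disk i 1 \<inter> critical_orbit p c" for i
  proof (cases "m \<le> i")
    case True
    have "\<exists>b\<ge>1. x (i + b) 1 = x i 1"
      using x_add_n[OF True, of 1] n0 by (intro exI[of _ n]) simp
    then have per: "periodic_vertex p c (disk i 1)" by (simp only: periodic_vertex_iff)
    have cluster_iff: "x j k = x i k \<longleftrightarrow> (\<exists>t<r. x j = x (i + t * d))" for j
    proof
      assume "x j k = x i k"
      then have "x j 1 = x i 1" using k by (rule level_mono)
      then show "\<exists>t<r. x j = x (i + t * d)" by (rule cluster_all[OF True])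
    next
      assume "\<exists>t<r. x j = x (i + t * d)"
      then obtain t where "x j = x (i + t * d)" by blast
      then show "x j k = x i k" using cluster[OF True, of t] by simp
    qed
    have "disk j k = disk i k" if "x j 1 = x i 1" for j
      unfolding disk_eq_iff using cluster_all[OF True that] cluster_iff by blast
    then have desc_k: "descendants p c k (disk i 1) = {disk i k}"
      unfolding descendants_disk[OF k] by blast
    have desc: "descendants p c (Suc k) (disk i k) =
        (\<lambda>t. disk (i + t * d) (Suc k)) ` {..<r}"
    proof -
      have "descendants p c (Suc k) (disk i k) = {disk j (Suc k) | j. x j k = x i k}"
        by (rule descendants_disk) simp
      also have "\<dots> = (\<lambda>t. disk (i + t * d) (Suc k)) ` {..<r}"
        unfolding cluster_iff disk_def by (auto simp: image_iff)
      finally show ?thesis .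
    qed
    have "inj_on (\<lambda>t. disk (i + t * d) (Suc k)) {..<r}"
      using cluster_inj[OF True] unfolding inj_on_def disk_eq_iff .
    then have card: "card (descendants p c (Suc k) (disk i k)) = r"
      unfolding desc by (simp add: card_image)
    have unique: "\<exists>!y. y \<in> disk (i + t * d) (Suc k) \<inter> critical_orbit p c" if "t < r" for t
    proof (rule ex1I[of _ "x (i + t * d)"])
      show "x (i + t * d) \<in> disk (i + t * d) (Suc k) \<inter> critical_orbit p c"
        by (simp add: x_in_disk critical_orbit_eq)
      fix y assume "y \<in> disk (i + t * d) (Suc k) \<inter> critical_orbit p c"
      then obtain j where j: "y = x j" "x j (Suc k) = x (i + t * d) (Suc k)"
        unfolding critical_orbit_eq by (auto simp: x_in_disk)
      then have "x j k = x i k" using level_mono[OF j(2), of k] cluster[OF True] by simp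
      then obtain u where u: "u < r" "x j = x (i + u * d)" using cluster_iff by blast
      then have "u = t" using inj_onD[OF cluster_inj[OF True], of u t] j(2) that by simp
      then show "y = x (i + t * d)" using u j(1) by simp
    qed
    have "\<forall>u\<in>descendants p c (Suc k) (disk i k). \<exists>!y. y \<in> u \<inter> critical_orbit p c"
      unfolding desc using unique by blast
    with desc_k card show ?thesis unfolding if_P[OF per] by (intro exI[of _ "disk i k"] conjI)
  next
    case False
    then have iso: "i = j" if "x i 1 = x j 1" for j using tail_isolated_mod[OF _ that] by simp
    then have "\<not> periodic_vertex p c (disk i 1)"
      unfolding periodic_vertex_iff
    proof (intro notI, elim exE conjE)
      fix b :: nat assume "1 \<le> b" "x (i + b) 1 = x i 1"
      with iso[of "i + b"] show False by simp
    qed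
    moreover have "\<exists>!y. y \<in> disk i 1 \<inter> critical_orbit p c"
    proof (rule ex1I[of _ "x i"])
      fix y assume "y \<in> disk i 1 \<inter> critical_orbit p c"
      then obtain j where j: "y = x j" "x j 1 = x i 1"
        unfolding critical_orbit_eq by (auto simp: x_in_disk)
      then show "y = x i" using iso[of j] by simp
    qed (simp add: x_in_disk critical_orbit_eq)
    ultimately show ?thesis by (simp only: if_False)
  qed
  show ?thesis unfolding one_branching_def critical_orbit_tree_level
    by (intro exI[of _ k], intro conjI[OF k] exI[of _ r], intro conjI[OF r(1)])
      (simp only: ball_simps, rule allI, rule level_1)
qed

end

section \<open>Periodic critical orbits\<close>

text \<open>
  Every simple path in a star goes through its centre at most once, which leaves one candidate for
  each pair of end points.
\<close>

lemma star_treeI: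
  assumes "finite L" "z \<notin> L" and V: "pverts T = insert z L" and A: "parcs T = {z} \<times> L \<union> L \<times> {z}"
  shows "star_tree T z (card L)"
proof -
  interpret pair_graph T
  proof
    show "finite (pverts T)" "finite (parcs T)" using \<open>finite L\<close> by (simp_all add: V A)
    show "symmetric (with_proj T)" by (auto simp: symmetric_def sym_def A)
  qed (use \<open>z \<notin> L\<close> in \<open>auto simp: V A\<close>)
  have from_z: "q = (if v = z then [] else [(z, v)])" if "apath z q v" for q v
  proof (cases q)
    case Nil
    then show ?thesis using that by (simp add: apath_Nil_iff)
  next
    case (Cons e q')
    then have e: "fst e = z" "snd e \<in> L" and q': "apath (snd e) q' v" "z \<notin> set (pawalk_verts (snd e) q')"
      using that \<open>z \<notin> L\<close> by (auto simp: apath_Cons_iff A)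
    have "q' = []"
    proof (cases q')
      case (Cons f q'')
      then have "f \<in> parcs T" "fst f = snd e" and f: "apath (snd f) q'' v"
        using q'(1) by (simp_all add: apath_Cons_iff)
      then have "snd f = z" using e(2) \<open>z \<notin> L\<close> by (auto simp: A)
      then have "z \<in> set (pawalk_verts (snd e) q')"
        unfolding Cons using hd_in_awalk_verts(2)[OF f] by simp
      with q'(2) show ?thesis by blast
    qed
    then have "v = snd e" using q'(1) by (simp add: apath_Nil_iff)
    then show ?thesis using e \<open>q' = []\<close> Cons \<open>z \<notin> L\<close> by (cases e) auto
  qed
  have path_z: "apath z (if v = z then [] else [(z, v)]) v" if "v \<in> pverts T" for v
    using that \<open>z \<notin> L\<close> by (auto simp: apath_Cons_iff apath_Nil_iff V A)
  have unique: "\<exists>!q. apath u q v" if u: "u \<in> pverts T" and v: "v \<in> pverts T" for u v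
  proof (cases "u = z")
    case True
    then show ?thesis using from_z path_z[OF v] by blast
  next
    case False
    then have "u \<in> L" using u by (simp add: V)
    show ?thesis
    proof (cases "u = v")
      case True
      show ?thesis
      proof (rule ex1I[of _ "[]"])
        show "apath u [] v" using u True by (simp add: apath_Nil_iff)
        fix q assume q: "apath u q v"
        show "q = []"
          using q True apath_nonempty_ends by blast
      qed
    next
      case neq: False
      let ?q = "(u, z) # (if v = z then [] else [(z, v)])"
      show ?thesis
      proof (rule ex1I[of _ ?q])
        show "apath u ?q v"
          using path_z[OF v] \<open>u \<in> L\<close> neq False by (auto simp: apath_Cons_iff A)
        fix q assume q: "apath u q v"
        with neq obtain e q' where Cons: "q = e # q'" by (cases q) (auto simp: apath_Nil_iff)
        then have "e \<in> parcs T" "fst e = u" "apath (snd e) q' v"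
          using q by (simp_all add: apath_Cons_iff)
        then have "e = (u, z)" using \<open>u \<in> L\<close> \<open>z \<notin> L\<close> by (cases e) (auto simp: A)
        then show "q = ?q" using from_z[of q' v] \<open>apath (snd e) q' v\<close> Cons by simp
      qed
    qed
  qed
  have "finite_tree T"
    unfolding finite_tree_def
  proof (intro conjI ballI)
    show "pverts T \<noteq> {}" by (simp add: V)
  qed (use unique pair_graph_axioms in blast)+
  moreover have "out_arcs T z = {z} \<times> L"
    using \<open>z \<notin> L\<close> by (auto simp: out_arcs_def A)
  then have "out_degree T z = card L" by (simp add: out_degree_def card_cartesian_product)
  moreover have "out_arcs T v = {(v, z)}" if "v \<in> L" for v
    using that \<open>z \<notin> L\<close> by (auto simp: out_arcs_def A)
  then have "out_degree T v = 1" if "v \<in> L" for v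
    using that by (simp add: out_degree_def)
  moreover have "pverts T - {z} = L" using \<open>z \<notin> L\<close> by (auto simp: V)
  ultimately show ?thesis by (simp add: star_tree_def V A)
qed

context finite_critical_orbit
begin

lemma root_eq_disk: "tree_root p = disk i 0"
proof -
  have "y 0 = x i 0" if "y \<in> carrier (Zp p)" for y
    using Zp_mod[OF that, of 0] Zp_mod[OF x_closed, of i 0] by simp
  then show ?thesis unfolding tree_root_eq[OF p2] disk_eq by blast
qed

lemma critical_orbit_tree_mod_verts:
  "pverts (critical_orbit_tree_mod p c) = insert (tree_root p) (range (\<lambda>i. disk i 1))"
  by (simp only: critical_orbit_tree_mod_def induced_def critical_orbit_tree_level
      pair_pre_digraph.simps)

lemma root_not_level_1: "tree_root p \<notin> range (\<lambda>i. disk i 1)"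
proof
  assume "tree_root p \<in> range (\<lambda>i. disk i 1)"
  then obtain i where "disk 0 0 = disk i 1" unfolding root_eq_disk[of 0] by blast
  with disk_level[of 0 0 0] disk_level[of i 1 0] show False by simp
qed

lemma critical_orbit_tree_mod_arcs:
  "parcs (critical_orbit_tree_mod p c) =
     {tree_root p} \<times> range (\<lambda>i. disk i 1) \<union> range (\<lambda>i. disk i 1) \<times> {tree_root p}"
proof -
  define R where "R = tree_root p"
  define L where "L = range (\<lambda>i. disk i 1)"
  have R_level: "R \<in> level p k \<longleftrightarrow> k = 0" for k
    unfolding R_def root_eq_disk[of 0] disk_level by (rule eq_commute)
  have L_level: "v \<in> level p k \<longleftrightarrow> k = 1" if "v \<in> L" for v k
  proof -
    obtain i where "v = disk i 1" using \<open>v \<in> L\<close> unfolding L_def by blast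
    then show ?thesis using disk_level[of i 1 k] by (simp only: eq_commute)
  qed
  have sub: "v \<subseteq> R" if "v \<in> L" for v
  proof -
    obtain i where "v = disk i 1" using \<open>v \<in> L\<close> unfolding L_def by blast
    then show ?thesis by (simp add: R_def disk_eq tree_root_eq[OF p2])
  qed
  have edge: "(\<exists>k. u \<in> level p k \<and> v \<in> level p (Suc k) \<and> v \<subseteq> u) \<longleftrightarrow> u = R \<and> v \<in> L"
    if "u \<in> insert R L" "v \<in> insert R L" for u v
  proof
    assume "\<exists>k. u \<in> level p k \<and> v \<in> level p (Suc k) \<and> v \<subseteq> u"
    then obtain k where k: "u \<in> level p k" "v \<in> level p (Suc k)" by blast
    have "v \<noteq> R" using k(2) R_level[of "Suc k"] by (cases "v = R") simp_all
    then have "v \<in> L" using that by simp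
    then have "k = 0" using L_level[of v "Suc k"] k(2) by simp
    then have "u \<notin> L" using k(1) L_level[of u 0] by (cases "u \<in> L") simp_all
    with \<open>v \<in> L\<close> that show "u = R \<and> v \<in> L" by blast
  next
    assume uv: "u = R \<and> v \<in> L"
    then have "u \<in> level p 0" "v \<in> level p (Suc 0)" "v \<subseteq> u"
      using R_level[of 0] L_level[of v "Suc 0"] sub[of v] by simp_all
    then show "\<exists>k. u \<in> level p k \<and> v \<in> level p (Suc k) \<and> v \<subseteq> u" by blast
  qed
  have "(u, v) \<in> parcs (padic_tree p) \<longleftrightarrow> u = R \<and> v \<in> L \<or> v = R \<and> u \<in> L"
    if "u \<in> insert R L" "v \<in> insert R L" for u v
    using edge[OF that] edge[OF that(2,1)] unfolding padic_tree_def pair_pre_digraph.simps by blast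
  then have "parcs (padic_tree p) \<inter> (insert R L \<times> insert R L) = {R} \<times> L \<union> L \<times> {R}"
    by blast
  moreover have "parcs (critical_orbit_tree_mod p c) =
      parcs (padic_tree p) \<inter> (insert R L \<times> insert R L)"
    by (simp only: critical_orbit_tree_mod_def induced_def critical_orbit_tree_level
        pair_pre_digraph.simps R_def L_def)
  ultimately have "parcs (critical_orbit_tree_mod p c) = {R} \<times> L \<union> L \<times> {R}"
    by (rule trans[rotated])
  then show ?thesis unfolding R_def L_def .
qed

text \<open>
  The points \<open>x i\<close> with \<open>i < n\<close> are distinct modulo \<open>p\<close>, so trimming leaves the root and \<open>n\<close> vertices of
  level \<open>1\<close>. The action on these is the action on the orbit, transported by the map that takes a point
  to its residue class.
\<close>

lemma periodic_critical_orbit: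
  assumes "has_exact_period (quad_map p c) \<zero>\<^bsub>Zp p\<^esub> n"
  shows "coincides_mod p c"
    and "star_tree (trimmed_critical_orbit_tree p c) (tree_root p) n"
    and "cyclic_on (vertex_map p c) (pverts (trimmed_critical_orbit_tree p c) - {tree_root p})"
    and "card (critical_orbit p c) = n"
    and "cyclic_on (quad_map p c) (critical_orbit p c)"
proof -
  have n: "0 < n" "x n = x 0" and least: "\<And>j. 0 < j \<Longrightarrow> j < n \<Longrightarrow> x j \<noteq> x 0"
    using assms by (auto simp: has_exact_period_iff)
  have modn: "x (i mod n) = x i" for i using n(2) by (rule periodic_x_mod)
  have inj: "inj_on (\<lambda>i. x i 1) {..<n}"
    by (rule linorder_inj_onI) (use periodic_distinct_mod[OF n least] in auto)
  have range: "range x = x ` {..<n}"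
    using modn n(1) by (auto intro!: image_eqI[of _ x, OF modn[symmetric]])
  show coincides: "coincides_mod p c"
  proof (rule coincides_modI)
    fix i j assume "x i 1 = x j 1"
    then have "i mod n = j mod n"
      using inj_onD[OF inj, of "i mod n" "j mod n"] n(1) by (simp add: modn)
    then show "x i = x j" using modn by metis
  qed
  have trimmed: "trimmed_critical_orbit_tree p c = critical_orbit_tree_mod p c"
    using coincides coincides_mod_iff[OF p2 c] by blast
  have disks: "range (\<lambda>i. disk i 1) = (\<lambda>i. disk i 1) ` {..<n}"
  proof -
    have "disk i 1 \<in> (\<lambda>i. disk i 1) ` {..<n}" for i
      by (rule image_eqI[of _ _ "i mod n"]) (simp_all add: disk_def modn n(1))
    then show ?thesis by blast
  qed
  have "inj_on (\<lambda>i. disk i 1) {..<n}"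
    using inj unfolding inj_on_def disk_eq_iff .
  then have card: "card (range (\<lambda>i. disk i 1)) = n"
    unfolding disks by (simp add: card_image)
  have "star_tree (critical_orbit_tree_mod p c) (tree_root p) (card (range (\<lambda>i. disk i 1)))"
    by (rule star_treeI[OF _ root_not_level_1 critical_orbit_tree_mod_verts
          critical_orbit_tree_mod_arcs]) (unfold disks, simp)
  then show "star_tree (trimmed_critical_orbit_tree p c) (tree_root p) n"
    unfolding trimmed card .
  have "inj_on x {..<n}" using inj by (rule inj_on_imageI2[of "\<lambda>y. y 1", unfolded comp_def])
  then show "card (critical_orbit p c) = n"
    unfolding critical_orbit_eq range by (simp add: card_image)
  have "range x = orbit (quad_map p c) (x 0)"
  proof -
    have "orbit (quad_map p c) (x 0) = {x i | i. 0 < i}"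
      by (simp add: orbit_altdef x_def)
    moreover have "x i \<in> {x i | i. 0 < i}" for i
    proof -
      have "x i = x (i + n)" using modn[of i] modn[of "i + n"] by simp
      then show ?thesis using n(1) by (intro CollectI exI[of _ "i + n"]) simp
    qed
    ultimately show ?thesis by blast
  qed
  then show cyclic: "cyclic_on (quad_map p c) (critical_orbit p c)"
    unfolding critical_orbit_eq cyclic_on_def by blast
  have "cyclic_on (vertex_map p c) ((\<lambda>y. closed_disk p y (1 / real p ^ 1)) ` critical_orbit p c)"
    using cyclic
    by (rule cyclic_on_image)
      (rule vertex_map_closed_disk[OF p2 c critical_orbit_closed[OF p0 c]])
  moreover have "(\<lambda>y. closed_disk p y (1 / real p ^ 1)) ` critical_orbit p c = range (\<lambda>i. disk i 1)"
    unfolding critical_orbit_eq disk_def by (rule image_image)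
  moreover have "pverts (trimmed_critical_orbit_tree p c) - {tree_root p} = range (\<lambda>i. disk i 1)"
    unfolding trimmed critical_orbit_tree_mod_verts using root_not_level_1 by blast
  ultimately show "cyclic_on (vertex_map p c) (pverts (trimmed_critical_orbit_tree p c) - {tree_root p})"
    by simp
qed

end

section \<open>The classification\<close>

theorem theorem1p4:
  fixes p :: nat and c :: "nat \<Rightarrow> int"
  assumes "prime p" and "3 \<le> p"
    and "c \<in> carrier (Zp p)"
    and "finite (critical_orbit p c)"
  shows
    "(\<forall>n. has_exact_period (quad_map p c) \<zero>\<^bsub>Zp p\<^esub> n \<longrightarrow>
        coincides_mod p c \<and>
        star_tree (trimmed_critical_orbit_tree p c) (tree_root p) n \<and>
        cyclic_on (vertex_map p c) (pverts (trimmed_critical_orbit_tree p c) - {tree_root p}) \<and>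
        card (critical_orbit p c) = n \<and>
        cyclic_on (quad_map p c) (critical_orbit p c)) \<and>
     (\<forall>m n. has_orbit_type (quad_map p c) \<zero>\<^bsub>Zp p\<^esub> m n \<and> 0 < m \<longrightarrow>
        coincides_mod p c \<or> one_branching p c)"
proof -
  interpret finite_critical_orbit p c
    by (rule finite_critical_orbit.intro) fact+
  have "coincides_mod p c \<or> one_branching p c"
    if "has_orbit_type (quad_map p c) \<zero>\<^bsub>Zp p\<^esub> m n" "0 < m" for m n
  proof -
    interpret preperiodic_critical_orbit p c m n
      using that by unfold_locales
    show ?thesis using coincides_if_no_branching one_branching_if_branching by blast
  qed
  then have "\<forall>m n. has_orbit_type (quad_map p c) \<zero>\<^bsub>Zp p\<^esub> m n \<and> 0 < m \<longrightarrow>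
      coincides_mod p c \<or> one_branching p c"
    by (intro allI impI) (erule conjE, assumption)
  moreover have "\<forall>n. has_exact_period (quad_map p c) \<zero>\<^bsub>Zp p\<^esub> n \<longrightarrow>
      coincides_mod p c \<and>
      star_tree (trimmed_critical_orbit_tree p c) (tree_root p) n \<and>
      cyclic_on (vertex_map p c) (pverts (trimmed_critical_orbit_tree p c) - {tree_root p}) \<and>
      card (critical_orbit p c) = n \<and>
      cyclic_on (quad_map p c) (critical_orbit p c)"
    by (intro allI impI conjI) (rule periodic_critical_orbit, assumption)+
  ultimately show ?thesis by (intro conjI)
qed

end
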